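(* Let $\nabla$ be a torsion-free connection on a smooth manifold $M$ and $X,Y\in\mathfrak{X}(M)$. All of the six relations (of operators on $\Upsilon^\bullet(M)$) $$[\iota_X,\iota_Y]=0,\qquad[\nabla^s,\nabla^s]=0,\qquad[\iota_X,\nabla^s]=L^s_X,$$ $$[L^s_X,\iota_Y]=\iota_{[X,Y]_s},\qquad[L^s_X,L^s_Y]=L^s_{[X,Y]_s},\qquad[\nabla^s,L^s_X]=0$$ are satisfied if and only if $X\in\mathrm{aff}_0(M,\nabla)$.
   Context: $M$ is a smooth manifold of positive dimension; a connection on $M$ is an affine connection on $TM$, extended to tensor fields. $\Upsilon^r(M)=\Gamma(\mathrm{Sym}^rT^*M)$ is the space of totally symmetric covariant $r$-tensor fields, $\Upsilon^0(M)=C^\infty(M)$, $\Upsilon^\bullet(M)=\bigoplus_r\Upsilon^r(M)$. Brackets of operators are ordinary commutators $[D,D']=D\circ D'-D'\circ D$. $\iota_X$ is the contraction with $X$ in the first argument (zero on functions). The symmetric derivative is $\nabla^sf=df$ and $(\nabla^s\varphi)(X_1,\dots,X_{r+1})=\sum_j(\nabla_{X_j}\varphi)(X_1,\dots,\hat X_j,\dots,X_{r+1})$ for $\varphi\in\Upsilon^r(M)$. The symmetric Lie derivative is defined by $L^s_X=\iota_X\circ\nabla^s-\nabla^s\circ\iota_X$, and the symmetric bracket is $[X,Y]_s=\nabla_XY+\nabla_YX$. A vector field $X$ is affine, $X\in\mathrm{aff}(M,\nabla)$, if its flow is a local one-parameter group of affine diffeomorphisms (diffeomorphisms whose tangent map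 commutes with parallel transport along curves); equivalently, $[X,\nabla_YZ]-\nabla_Y[X,Z]=\nabla_{[X,Y]}Z$ (Lie brackets of vector fields) for all $Y,Z\in\mathfrak{X}(M)$. $\mathrm{aff}_0(M,\nabla)=\{X\in\mathrm{aff}(M,\nabla)\mid\nabla X=0\}$. *)

theory Defs
  imports "HOL-Analysis.Analysis" "HOL-Library.Function_Algebras"
begin

section \<open>Smooth manifolds\<close>

primrec Ck_on :: "nat \<Rightarrow> 'e::euclidean_space set \<Rightarrow> ('e \<Rightarrow> 'f::real_normed_vector) \<Rightarrow> bool" where
  "Ck_on 0 S f \<longleftrightarrow> continuous_on S f"
| "Ck_on (Suc k) S f \<longleftrightarrow> (\<forall>x\<in>S. f differentiable (at x)) \<and>
     (\<forall>v. Ck_on k S (\<lambda>x. frechet_derivative f (at x) v))"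

text \<open>Only used for open \<open>S\<close>.\<close>

definition smooth_on :: "'e::euclidean_space set \<Rightarrow> ('e \<Rightarrow> 'f::real_normed_vector) \<Rightarrow> bool" where
  "smooth_on S f \<longleftrightarrow> (\<forall>k. Ck_on k S f)"

text \<open>The underlying space of the manifold is the whole type \<open>'a\<close> with its class topology. A chart
  is a pair \<open>(U, \<kappa>)\<close> whose inverse is \<open>inv_into U \<kappa>\<close>; the values of \<open>\<kappa>\<close> outside \<open>U\<close> are
  irrelevant. The dimension is \<open>DIM('e)\<close>, which is positive for every Euclidean space.\<close>

type_synonym ('a, 'e) atlas = "('a set \<times> ('a \<Rightarrow> 'e)) set"

definition smooth_manifold ::
  "('a::{t2_space,second_countable_topology}, 'e::euclidean_space) atlas \<Rightarrow> bool" where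
  "smooth_manifold A \<longleftrightarrow>
     (\<forall>(U, \<kappa>)\<in>A. open U \<and> open (\<kappa> ` U) \<and> homeomorphism U (\<kappa> ` U) \<kappa> (inv_into U \<kappa>)) \<and>
     (\<Union>(U, \<kappa>)\<in>A. U) = UNIV \<and>
     (\<forall>(U, \<kappa>)\<in>A. \<forall>(V, \<mu>)\<in>A. smooth_on (\<kappa> ` (U \<inter> V)) (\<mu> \<circ> inv_into U \<kappa>))"

definition smooth_functions :: "('a, 'e::euclidean_space) atlas \<Rightarrow> ('a \<Rightarrow> real) set" where
  "smooth_functions A = {f. \<forall>(U, \<kappa>)\<in>A. smooth_on (\<kappa> ` U) (f \<circ> inv_into U \<kappa>)}"

section \<open>Vector fields\<close>

text \<open>Tangent vectors at \<open>p\<close> are the derivations at \<open>p\<close> of the algebra of smooth functions. They are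
  normalised to vanish on non-smooth functions, so that equality in HOL is equality of derivations.\<close>

type_synonym 'a tangent = "('a \<Rightarrow> real) \<Rightarrow> real"
type_synonym 'a vfield = "'a \<Rightarrow> 'a tangent"

definition tangent_space :: "('a, 'e::euclidean_space) atlas \<Rightarrow> 'a \<Rightarrow> 'a tangent set" where
  "tangent_space A p = {v.
     (\<forall>f\<in>smooth_functions A. \<forall>g\<in>smooth_functions A. \<forall>a b.
        v (\<lambda>x. a * f x + b * g x) = a * v f + b * v g) \<and>
     (\<forall>f\<in>smooth_functions A. \<forall>g\<in>smooth_functions A.
        v (\<lambda>x. f x * g x) = f p * v g + g p * v f) \<and>
     (\<forall>f. f \<notin> smooth_functions A \<longrightarrow> v f = 0)}"

definition vector_fields :: "('a, 'e::euclidean_space) atlas \<Rightarrow> 'a vfield set" where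
  "vector_fields A = {X. (\<forall>p. X p \<in> tangent_space A p) \<and>
     (\<forall>f\<in>smooth_functions A. (\<lambda>p. X p f) \<in> smooth_functions A)}"

definition scale_field :: "('a \<Rightarrow> real) \<Rightarrow> 'a vfield \<Rightarrow> 'a vfield" where
  "scale_field f X = (\<lambda>p g. f p * X p g)"

definition lie_bracket :: "'a vfield \<Rightarrow> 'a vfield \<Rightarrow> 'a vfield" where
  "lie_bracket X Y = (\<lambda>p f. X p (\<lambda>q. Y q f) - Y p (\<lambda>q. X q f))"

section \<open>Symmetric covariant tensor fields\<close>

text \<open>A covariant \<open>r\<close>-tensor field assigns to \<open>p\<close> a function of \<open>r\<close>-tuples (lists of length \<open>r\<close>) of
  tangent vectors at \<open>p\<close>, normalised to vanish on all other lists. A function \<open>f\<close> is identified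
  with the 0-tensor field whose value at \<open>p\<close> on the empty list is \<open>f p\<close>.\<close>

type_synonym 'a tensor_field = "'a \<Rightarrow> 'a tangent list \<Rightarrow> real"

definition sym_forms ::
  "('a, 'e::euclidean_space) atlas \<Rightarrow> nat \<Rightarrow> 'a \<Rightarrow> ('a tangent list \<Rightarrow> real) set" where
  "sym_forms A r p = {\<omega>.
     (\<forall>vs i u w a b. length vs = r \<and> set vs \<subseteq> tangent_space A p \<and> i < r \<and>
        u \<in> tangent_space A p \<and> w \<in> tangent_space A p \<longrightarrow>
        \<omega> (vs[i := (\<lambda>f. a * u f + b * w f)]) = a * \<omega> (vs[i := u]) + b * \<omega> (vs[i := w])) \<and>
     (\<forall>vs ws. length vs = r \<and> set vs \<subseteq> tangent_space A p \<and> mset ws = mset vs \<longrightarrow> \<omega> ws = \<omega> vs) \<and>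
     (\<forall>vs. \<not> (length vs = r \<and> set vs \<subseteq> tangent_space A p) \<longrightarrow> \<omega> vs = 0)}"

definition eval_tensor :: "'a tensor_field \<Rightarrow> 'a vfield list \<Rightarrow> 'a \<Rightarrow> real" where
  "eval_tensor \<phi> Xs = (\<lambda>p. \<phi> p (map (\<lambda>X. X p) Xs))"

text \<open>Smooth sections of the bundle of symmetric \<open>r\<close>-forms.\<close>

definition sym_tensors :: "('a, 'e::euclidean_space) atlas \<Rightarrow> nat \<Rightarrow> 'a tensor_field set" where
  "sym_tensors A r = {\<phi>. (\<forall>p. \<phi> p \<in> sym_forms A r p) \<and>
     (\<forall>Xs. length Xs = r \<and> set Xs \<subseteq> vector_fields A \<longrightarrow> eval_tensor \<phi> Xs \<in> smooth_functions A)}"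

text \<open>The direct sum over all degrees: \<open>\<Phi> r\<close> is the component of \<open>\<Phi>\<close> of degree \<open>r\<close>.\<close>

type_synonym 'a graded = "nat \<Rightarrow> 'a tensor_field"

definition sym_tensors_sum :: "('a, 'e::euclidean_space) atlas \<Rightarrow> 'a graded set" where
  "sym_tensors_sum A = {\<Phi>. (\<forall>r. \<Phi> r \<in> sym_tensors A r) \<and> finite {r. \<Phi> r \<noteq> 0}}"

section \<open>Connections\<close>

definition affine_connection ::
  "('a, 'e::euclidean_space) atlas \<Rightarrow> ('a vfield \<Rightarrow> 'a vfield \<Rightarrow> 'a vfield) \<Rightarrow> bool" where
  "affine_connection A D \<longleftrightarrow>
     (\<forall>X\<in>vector_fields A. \<forall>Y\<in>vector_fields A. D X Y \<in> vector_fields A) \<and>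
     (\<forall>X\<in>vector_fields A. \<forall>X'\<in>vector_fields A. \<forall>Y\<in>vector_fields A. D (X + X') Y = D X Y + D X' Y) \<and>
     (\<forall>X\<in>vector_fields A. \<forall>Y\<in>vector_fields A. \<forall>Y'\<in>vector_fields A. D X (Y + Y') = D X Y + D X Y') \<and>
     (\<forall>f\<in>smooth_functions A. \<forall>X\<in>vector_fields A. \<forall>Y\<in>vector_fields A.
        D (scale_field f X) Y = scale_field f (D X Y)) \<and>
     (\<forall>f\<in>smooth_functions A. \<forall>X\<in>vector_fields A. \<forall>Y\<in>vector_fields A.
        D X (scale_field f Y) = scale_field f (D X Y) + scale_field (\<lambda>p. X p f) Y)"

definition torsion_free ::
  "('a, 'e::euclidean_space) atlas \<Rightarrow> ('a vfield \<Rightarrow> 'a vfield \<Rightarrow> 'a vfield) \<Rightarrow> bool" where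
  "torsion_free A D \<longleftrightarrow>
     (\<forall>X\<in>vector_fields A. \<forall>Y\<in>vector_fields A. D X Y - D Y X = lie_bracket X Y)"

text \<open>Extension of \<open>D\<close> to \<open>\<phi> \<in> sym_tensors A r\<close> by the Leibniz rule
  \<open>(D\<^sub>X \<phi>)(Y\<^sub>1, \<dots>, Y\<^sub>r) = X (\<phi>(Y\<^sub>1, \<dots>, Y\<^sub>r)) - (\<Sum>i. \<phi>(Y\<^sub>1, \<dots>, D\<^sub>X Y\<^sub>i, \<dots>, Y\<^sub>r))\<close>.
  The right-hand side is tensorial in the \<open>Y\<^sub>i\<close>, and a tensor field is determined by its values on
  global vector fields, so the description is proper. For \<open>r = 0\<close> it says \<open>D\<^sub>X f = X f\<close>.\<close>

definition cov_deriv ::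
  "('a, 'e::euclidean_space) atlas \<Rightarrow> ('a vfield \<Rightarrow> 'a vfield \<Rightarrow> 'a vfield) \<Rightarrow> nat \<Rightarrow> 'a vfield \<Rightarrow>
   'a tensor_field \<Rightarrow> 'a tensor_field" where
  "cov_deriv A D r X \<phi> = (THE \<psi>. \<psi> \<in> sym_tensors A r \<and>
     (\<forall>Ys. length Ys = r \<and> set Ys \<subseteq> vector_fields A \<longrightarrow>
        (\<forall>p. eval_tensor \<psi> Ys p =
           X p (eval_tensor \<phi> Ys) - (\<Sum>i<r. eval_tensor \<phi> (Ys[i := D X (Ys ! i)]) p))))"

section \<open>Operators on symmetric tensor fields\<close>

text \<open>The symmetric derivative of \<open>\<phi> \<in> sym_tensors A r\<close>; the sum runs over the omitted index
  \<open>j\<close>. For \<open>r = 0\<close> the formula reads \<open>X\<^sub>1 \<mapsto> X\<^sub>1 f\<close>, that is, it gives \<open>df\<close>.\<close>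

definition sym_deriv ::
  "('a, 'e::euclidean_space) atlas \<Rightarrow> ('a vfield \<Rightarrow> 'a vfield \<Rightarrow> 'a vfield) \<Rightarrow> nat \<Rightarrow>
   'a tensor_field \<Rightarrow> 'a tensor_field" where
  "sym_deriv A D r \<phi> = (THE \<psi>. \<psi> \<in> sym_tensors A (Suc r) \<and>
     (\<forall>Xs. length Xs = Suc r \<and> set Xs \<subseteq> vector_fields A \<longrightarrow>
        (\<forall>p. eval_tensor \<psi> Xs p =
           (\<Sum>j<Suc r. eval_tensor (cov_deriv A D r (Xs ! j) \<phi>) (take j Xs @ drop (Suc j) Xs) p))))"

text \<open>The graded operators: \<open>Nabla_s\<close> raises the degree by one, \<open>iota X\<close> lowers it by one
  (in particular it annihilates the component of degree 0).\<close>

definition Nabla_s ::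
  "('a, 'e::euclidean_space) atlas \<Rightarrow> ('a vfield \<Rightarrow> 'a vfield \<Rightarrow> 'a vfield) \<Rightarrow>
   'a graded \<Rightarrow> 'a graded" where
  "Nabla_s A D \<Phi> = (\<lambda>r. case r of 0 \<Rightarrow> 0 | Suc k \<Rightarrow> sym_deriv A D k (\<Phi> k))"

definition iota :: "'a vfield \<Rightarrow> 'a graded \<Rightarrow> 'a graded" where
  "iota X \<Phi> = (\<lambda>r p vs. \<Phi> (Suc r) p (X p # vs))"

definition sym_Lie ::
  "('a, 'e::euclidean_space) atlas \<Rightarrow> ('a vfield \<Rightarrow> 'a vfield \<Rightarrow> 'a vfield) \<Rightarrow> 'a vfield \<Rightarrow>
   'a graded \<Rightarrow> 'a graded" where
  "sym_Lie A D X \<Phi> = iota X (Nabla_s A D \<Phi>) - Nabla_s A D (iota X \<Phi>)"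

definition sym_bracket ::
  "('a vfield \<Rightarrow> 'a vfield \<Rightarrow> 'a vfield) \<Rightarrow> 'a vfield \<Rightarrow> 'a vfield \<Rightarrow> 'a vfield" where
  "sym_bracket D X Y = D X Y + D Y X"

definition commutator ::
  "('a graded \<Rightarrow> 'a graded) \<Rightarrow> ('a graded \<Rightarrow> 'a graded) \<Rightarrow> 'a graded \<Rightarrow> 'a graded" where
  "commutator P Q = (\<lambda>\<Phi>. P (Q \<Phi>) - Q (P \<Phi>))"

definition op_eq_on ::
  "('a, 'e::euclidean_space) atlas \<Rightarrow> ('a graded \<Rightarrow> 'a graded) \<Rightarrow> ('a graded \<Rightarrow> 'a graded) \<Rightarrow> bool" where
  "op_eq_on A P Q \<longleftrightarrow> (\<forall>\<Phi>\<in>sym_tensors_sum A. P \<Phi> = Q \<Phi>)"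

section \<open>Affine vector fields\<close>

text \<open>A field is affine if its flow preserves the connection; this is expressed infinitesimally
  as the vanishing of the Lie derivative of \<open>D\<close> along it.\<close>

definition aff ::
  "('a, 'e::euclidean_space) atlas \<Rightarrow> ('a vfield \<Rightarrow> 'a vfield \<Rightarrow> 'a vfield) \<Rightarrow> 'a vfield set" where
  "aff A D = {X\<in>vector_fields A. \<forall>Y\<in>vector_fields A. \<forall>Z\<in>vector_fields A.
     lie_bracket X (D Y Z) - D Y (lie_bracket X Z) = D (lie_bracket X Y) Z}"

definition aff0 ::
  "('a, 'e::euclidean_space) atlas \<Rightarrow> ('a vfield \<Rightarrow> 'a vfield \<Rightarrow> 'a vfield) \<Rightarrow> 'a vfield set" where
  "aff0 A D = {X\<in>aff A D. \<forall>Y\<in>vector_fields A. D Y X = 0}"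

end

theory Submission
  imports Defs
begin

text \<open>
  Write \<open>L\<^sub>X\<close> for the symmetric Lie derivative, \<open>[X, Y]\<^sub>s\<close> for the symmetric bracket and
  \<open>K\<^sub>X\<^sub>Y = [L\<^sub>X, L\<^sub>Y] - L\<close> along \<open>[X, Y]\<^sub>s\<close>. On vector fields \<open>L\<^sub>X\<close> is given by
  \<open>(L\<^sub>X \<phi>)(Z\<^sub>1, \<dots>, Z\<^sub>r) = X (\<phi>(Z\<^sub>1, \<dots>, Z\<^sub>r)) - (\<Sum>j. \<phi>(Z\<^sub>1, \<dots>, [X, Z\<^sub>j]\<^sub>s, \<dots>, Z\<^sub>r))\<close>
  (lemma \<open>eval_Lie\<close>), so \<open>[L\<^sub>X, \<iota>\<^sub>Y]\<close> is the contraction with \<open>[X, Y]\<^sub>s\<close> for all \<open>X\<close> and \<open>Y\<close>; the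
  first three relations are formal. The fifth and the sixth are compared by means of the Jacobi identity
  for commutators, which gives

  \<^item> \<open>[[\<nabla>\<^sup>s, L\<^sub>X], \<iota>\<^sub>Z] = K\<^sub>X\<^sub>Z\<close> (lemma \<open>commutator_Nabla_Lie_iota\<close>),

  \<^item> \<open>[K\<^sub>X\<^sub>Y, \<iota>\<^sub>Z]\<close> is the contraction with \<open>[X, [Y, Z]\<^sub>s]\<^sub>s - [Y, [X, Z]\<^sub>s]\<^sub>s - [[X, Y]\<^sub>s, Z]\<^sub>s\<close>
    (lemma \<open>Lie_defect_iota\<close>).

  A symmetric tensor field of positive degree is zero once all its contractions are, so an operator
  that commutes with all contractions vanishes as soon as its values have no component of degree
  zero (lemma \<open>operator_vanishes_by_iota\<close>). Hence \<open>\<nabla>\<^sup>s\<close> commutes with \<open>L\<^sub>X\<close> iff \<open>K\<^sub>X\<^sub>Z = 0\<close> for every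
  \<open>Z\<close>, and this holds iff every \<open>K\<^sub>X\<^sub>Z\<close> annihilates functions and the vector fields of the second
  item are zero. On functions \<open>K\<^sub>X\<^sub>Z\<close> is the Lie bracket \<open>[X, Z]\<close> minus \<open>[X, Z]\<^sub>s\<close>, that is \<open>- 2 \<nabla>\<^sub>Z X\<close>, so the first
  condition says that \<open>X\<close> is parallel. For parallel \<open>X\<close> the vector field in the second condition is
  \<open>R(X, Y) Z + R(X, Z) Y\<close>, and the Jacobi identity of the Lie bracket makes \<open>R(X, Y) Z\<close> symmetric in
  \<open>Y\<close> and \<open>Z\<close>; so the second condition says \<open>R(X, Y) Z = 0\<close>, which for parallel \<open>X\<close> is the condition
  that \<open>X\<close> is affine.

  The computation rests on evaluating tensor fields on global vector fields. That \<open>\<nabla>\<close> and \<open>\<nabla>\<^sup>s\<close>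
  of a tensor field exist and are determined by their values on vector fields is the statement that
  symmetric maps multilinear over the smooth functions are the same as symmetric tensor fields
  (lemma \<open>sym_multilinear_imp_tensor\<close>). Both halves follow from a frame that is global up to a cutoff
  function (lemma \<open>local_frame\<close>); its construction is the classical proof that the derivations at a
  point are spanned by the partial derivatives, by bump functions and the Hadamard lemma.
\<close>

section \<open>Calculus of \<open>k\<close> times differentiable functions\<close>

lemma Ck_on_cong:
  assumes "open S" "Ck_on k S f" "\<And>x. x \<in> S \<Longrightarrow> f x = g x"
  shows "Ck_on k S g"
  using assms(2,3)
proof (induction k arbitrary: f g)
  case 0
  then show ?case by (simp cong: continuous_on_cong)
next
  case (Suc k)
  have diff: "g differentiable (at x)" if "x \<in> S" for x
  proof -
    have "(f has_derivative frechet_derivative f (at x)) (at x)"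
      using Suc.prems(1) that frechet_derivative_works by auto
    then show ?thesis
      unfolding differentiable_def
      by (intro exI has_derivative_transform_within_open[OF _ \<open>open S\<close> that Suc.prems(2)])
  qed
  have "Ck_on k S (\<lambda>x. frechet_derivative g (at x) v)" for v
  proof (rule Suc.IH)
    show "Ck_on k S (\<lambda>x. frechet_derivative f (at x) v)" using Suc.prems(1) by simp
    show "frechet_derivative f (at x) v = frechet_derivative g (at x) v" if "x \<in> S" for x
      using frechet_derivative_transform_within_open[OF _ \<open>open S\<close> that Suc.prems(2)]
        Suc.prems(1) that by simp
  qed
  then show ?case using diff by simp
qed

text \<open>Any derivative serves as witness: on an open set it is unique, so it agrees there with
  \<^const>\<open>frechet_derivative\<close>.\<close>

lemma Ck_on_SucI:
  assumes "open S" "\<And>x. x \<in> S \<Longrightarrow> (f has_derivative f' x) (at x)"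
    and "\<And>v. Ck_on k S (\<lambda>x. f' x v)"
  shows "Ck_on (Suc k) S f"
proof -
  have eq: "f' x v = frechet_derivative f (at x) v" if "x \<in> S" for x v
    using assms(2)[OF that] frechet_derivative_at by metis
  have "Ck_on k S (\<lambda>x. frechet_derivative f (at x) v)" for v
    by (rule Ck_on_cong[OF assms(1) assms(3)[of v] eq])
  then show ?thesis
    using assms(2) by (auto simp: differentiable_def)
qed

lemma Ck_on_SucD:
  assumes "Ck_on (Suc k) S f" "x \<in> S"
  shows "(f has_derivative frechet_derivative f (at x)) (at x)"
  using assms frechet_derivative_works by auto

lemma Ck_on_pred: "Ck_on (Suc k) S f \<Longrightarrow> Ck_on k S f"
proof (induction k arbitrary: f)
  case 0
  then have "f differentiable_on S"
    by (auto simp: differentiable_on_def intro: differentiable_at_withinI)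
  then show ?case using differentiable_imp_continuous_on by auto
next
  case (Suc k)
  have "Ck_on k S (\<lambda>x. frechet_derivative f (at x) v)" for v
    using Suc.prems by (intro Suc.IH) simp
  then show ?case using Suc.prems by simp
qed

lemma Ck_on_imp_continuous_on: "Ck_on k S f \<Longrightarrow> continuous_on S f"
  by (induction k) (simp, metis Ck_on_pred)

lemma Ck_on_subset: "Ck_on k S f \<Longrightarrow> T \<subseteq> S \<Longrightarrow> Ck_on k T f"
  by (induction k arbitrary: f) (auto intro: continuous_on_subset)

lemma Ck_on_locally:
  assumes "\<And>x. x \<in> S \<Longrightarrow> \<exists>T. open T \<and> x \<in> T \<and> Ck_on k T f"
  shows "Ck_on k S f"
  using assms
proof (induction k arbitrary: f)
  case 0
  show ?case
    unfolding Ck_on.simps continuous_on_eq_continuous_within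
  proof
    fix x assume "x \<in> S"
    then obtain T where "open T" "x \<in> T" "continuous_on T f" using 0 by auto
    then show "continuous (at x within S) f"
      by (simp add: continuous_on_eq_continuous_at continuous_at_imp_continuous_at_within)
  qed
next
  case (Suc k)
  have "f differentiable (at x)" if "x \<in> S" for x
    using Suc.prems[OF that] by auto
  moreover have "Ck_on k S (\<lambda>x. frechet_derivative f (at x) v)" for v
  proof (rule Suc.IH)
    fix x assume "x \<in> S"
    then show "\<exists>T. open T \<and> x \<in> T \<and> Ck_on k T (\<lambda>x. frechet_derivative f (at x) v)"
      using Suc.prems[of x] by auto
  qed
  ultimately show ?case by simp
qed

lemma Ck_on_const: "Ck_on k S (\<lambda>x. c)"
  by (induction k arbitrary: c) auto

lemma Ck_on_bounded_linear_compose: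
  assumes "open S" "bounded_linear L" "Ck_on k S f"
  shows "Ck_on k S (\<lambda>x. L (f x))"
  using assms(3)
proof (induction k arbitrary: f)
  case 0
  then show ?case using bounded_linear.continuous_on[OF assms(2)] by simp
next
  case (Suc k)
  show ?case
    by (rule Ck_on_SucI[OF \<open>open S\<close>
          bounded_linear.has_derivative[OF assms(2) Ck_on_SucD[OF Suc.prems]]])
       (use Suc in auto)
qed

lemma Ck_on_id: "open S \<Longrightarrow> Ck_on k S (\<lambda>x. x)"
  by (cases k) (simp_all add: Ck_on_SucI[where f' = "\<lambda>x v. v"] Ck_on_const del: Ck_on.simps(2))

lemma Ck_on_bounded_linear: "open S \<Longrightarrow> bounded_linear L \<Longrightarrow> Ck_on k S L"
  using Ck_on_bounded_linear_compose[OF _ _ Ck_on_id, of S L] by simp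

lemma Ck_on_add:
  assumes "open S" "Ck_on k S f" "Ck_on k S g"
  shows "Ck_on k S (\<lambda>x. f x + g x)"
  using assms(2,3)
proof (induction k arbitrary: f g)
  case 0
  then show ?case by (auto intro: continuous_on_add)
next
  case (Suc k)
  show ?case
    by (rule Ck_on_SucI[OF \<open>open S\<close>
          has_derivative_add[OF Ck_on_SucD[OF Suc.prems(1)] Ck_on_SucD[OF Suc.prems(2)]]])
      (use Suc in auto)
qed

lemma Ck_on_sum:
  assumes "open S" "\<And>i. i \<in> I \<Longrightarrow> Ck_on k S (f i)"
  shows "Ck_on k S (\<lambda>x. \<Sum>i\<in>I. f i x)"
  using assms(2)
  by (induction I rule: infinite_finite_induct) (auto intro: Ck_on_const Ck_on_add[OF assms(1)])

lemma Ck_on_mult: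
  fixes f g :: "'a::euclidean_space \<Rightarrow> real"
  assumes "open S" "Ck_on k S f" "Ck_on k S g"
  shows "Ck_on k S (\<lambda>x. f x * g x)"
  using assms(2,3)
proof (induction k arbitrary: f g)
  case 0
  then show ?case by (auto intro: continuous_on_mult)
next
  case (Suc k)
  show ?case
    by (rule Ck_on_SucI[OF \<open>open S\<close>
          has_derivative_mult[OF Ck_on_SucD[OF Suc.prems(1)] Ck_on_SucD[OF Suc.prems(2)]]])
      (use Suc Ck_on_pred[OF Suc.prems(1)] Ck_on_pred[OF Suc.prems(2)] in
        \<open>auto intro!: Ck_on_add[OF assms(1)]\<close>)
qed

text \<open>The chain rule writes a directional derivative of \<open>f \<circ> g\<close> as a sum over a basis, so that its
  terms are products of functions to which the induction hypothesis applies.\<close>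

lemma Ck_on_compose:
  fixes f :: "'b::euclidean_space \<Rightarrow> real" and g :: "'a::euclidean_space \<Rightarrow> 'b"
  assumes "open S" "open T" "Ck_on k T f" "Ck_on k S g" "g ` S \<subseteq> T"
  shows "Ck_on k S (\<lambda>x. f (g x))"
  using assms(3,4)
proof (induction k arbitrary: f)
  case 0
  then show ?case using assms(5) by (auto intro: continuous_on_compose2)
next
  case (Suc k)
  show ?case
  proof (rule Ck_on_SucI[OF \<open>open S\<close>])
    fix x assume "x \<in> S"
    show "((\<lambda>x. f (g x)) has_derivative
        (\<lambda>v. frechet_derivative f (at (g x)) (frechet_derivative g (at x) v))) (at x)"
      using has_derivative_compose[OF Ck_on_SucD[OF Suc.prems(2) \<open>x \<in> S\<close>]
          Ck_on_SucD[OF Suc.prems(1)]] \<open>x \<in> S\<close> assms(5) by blast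
  next
    fix v
    have "Ck_on k S (\<lambda>x. \<Sum>b\<in>Basis. (frechet_derivative g (at x) v \<bullet> b) *
            frechet_derivative f (at (g x)) b)"
      using Suc Ck_on_pred[OF Suc.prems(2)]
      by (intro Ck_on_sum Ck_on_mult \<open>open S\<close> Suc.IH
          Ck_on_bounded_linear_compose[where L = "\<lambda>y. y \<bullet> b" for b] bounded_linear_inner_left) auto
    then show "Ck_on k S (\<lambda>x. frechet_derivative f (at (g x)) (frechet_derivative g (at x) v))"
    proof (rule Ck_on_cong[OF \<open>open S\<close>])
      fix x assume "x \<in> S"
      let ?w = "frechet_derivative g (at x) v"
      have lin: "linear (frechet_derivative f (at (g x)))"
        using Suc.prems(1) \<open>x \<in> S\<close> assms(5) linear_frechet_derivative by auto
      have "frechet_derivative f (at (g x)) ?w =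
          frechet_derivative f (at (g x)) (\<Sum>b\<in>Basis. (?w \<bullet> b) *\<^sub>R b)"
        by (simp add: euclidean_representation)
      then show "(\<Sum>b\<in>Basis. (?w \<bullet> b) * frechet_derivative f (at (g x)) b) =
          frechet_derivative f (at (g x)) ?w"
        by (simp add: linear_sum[OF lin] linear_scale[OF lin])
    qed
  qed
qed

section \<open>Bump functions on Euclidean spaces\<close>

text \<open>The index \<open>n\<close> is what makes smoothness inductive: \<open>flat_exp 0\<close> is the standard flat function
  \<open>exp (- 1 / t)\<close>, and the derivatives of the members of this family are linear combinations of members.\<close>

definition flat_exp :: "nat \<Rightarrow> real \<Rightarrow> real" where
  "flat_exp n t = (if t > 0 then (1 / t) ^ n * exp (- (1 / t)) else 0)"

text \<open>With \<open>x = 1 / t\<close> and \<open>m = n + 2\<close> this is \<open>x\<^sup>m \<le> m\<^sup>m exp x\<close>, the \<open>m\<close>-th power of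
  \<open>x / m \<le> exp (x / m)\<close>. The factor \<open>t\<^sup>2\<close> yields the zero derivative at the origin.\<close>

lemma flat_exp_le_square:
  "\<bar>flat_exp n t\<bar> \<le> real (n + 2) ^ (n + 2) * t\<^sup>2"
proof (cases "t > 0")
  case True
  let ?m = "real (n + 2)" and ?x = "1 / t"
  have pos: "0 < ?x" "0 < ?m" using True by auto
  have "?x / ?m \<le> exp (?x / ?m)"
    using exp_ge_add_one_self[of "?x / ?m"] by linarith
  then have "(?x / ?m) ^ (n + 2) \<le> exp (?x / ?m) ^ (n + 2)"
    using pos by (intro power_mono divide_nonneg_pos) (auto intro: less_imp_le)
  also have "\<dots> = exp ?x" by (rule exp_divide_power_eq) simp
  finally have le: "?x ^ (n + 2) \<le> ?m ^ (n + 2) * exp ?x"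
    using zero_less_power[OF pos(2)] by (simp only: power_divide pos_divide_le_eq mult.commute)
  have "?x ^ n * exp (- ?x) = ?x ^ (n + 2) * exp (- ?x) * t\<^sup>2"
    using True by (simp add: power_add power_divide power2_eq_square field_simps)
  also have "\<dots> \<le> ?m ^ (n + 2) * exp ?x * exp (- ?x) * t\<^sup>2"
    using le by (intro mult_right_mono) auto
  also have "\<dots> = ?m ^ (n + 2) * t\<^sup>2"
    by (simp add: exp_minus)
  finally show ?thesis using True by (simp add: flat_exp_def)
qed (simp add: flat_exp_def)

lemma flat_exp_has_derivative:
  "(flat_exp n has_real_derivative flat_exp (n + 2) t - real n * flat_exp (n + 1) t) (at t)"
proof -
  consider "t > 0" | "t < 0" | "t = 0" by linarith
  then show ?thesis
  proof cases
    case 1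
    have pow: "t * t ^ (m - Suc 0) = t ^ m" if "m \<noteq> 0" for m
      using that by (cases m) auto
    have "((\<lambda>t. (1 / t) ^ n * exp (- (1 / t))) has_real_derivative
        flat_exp (n + 2) t - real n * flat_exp (n + 1) t) (at t)"
      using 1 
      by (cases n; auto intro!: derivative_eq_intros simp: flat_exp_def field_simps power2_eq_square; metis pow)
    then show ?thesis
      by (rule has_field_derivative_transform_within_open[of _ _ _ "{0<..}"])
        (use 1 in \<open>auto simp: flat_exp_def\<close>)
  next
    case 2
    have "((\<lambda>t. 0) has_real_derivative flat_exp (n + 2) t - real n * flat_exp (n + 1) t) (at t)"
      using 2 by (auto simp: flat_exp_def)
    then show ?thesis
      by (rule has_field_derivative_transform_within_open[of _ _ _ "{..<0}"])
        (use 2 in \<open>auto simp: flat_exp_def\<close>)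
  next
    case 3
    have "((\<lambda>h. flat_exp n h / h) \<longlongrightarrow> 0) (at 0)"
    proof (rule Lim_null_comparison)
      show "\<forall>\<^sub>F h in at 0. norm (flat_exp n h / h) \<le> real (n + 2) ^ (n + 2) * \<bar>h\<bar>"
      proof (intro always_eventually allI)
        fix h :: real
        have "\<bar>flat_exp n h\<bar> \<le> (real (n + 2) ^ (n + 2) * \<bar>h\<bar>) * \<bar>h\<bar>"
          using flat_exp_le_square[of n h] by (simp add: power2_eq_square abs_mult_self_eq mult.assoc)
        then show "norm (flat_exp n h / h) \<le> real (n + 2) ^ (n + 2) * \<bar>h\<bar>"
          by (cases "h = 0") (auto simp: divide_le_eq)
      qed
      show "((\<lambda>h. real (n + 2) ^ (n + 2) * \<bar>h\<bar>) \<longlongrightarrow> (0::real)) (at 0)"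
        by (intro tendsto_mult_right_zero tendsto_rabs_zero tendsto_ident_at)
    qed
    then show ?thesis using 3 by (simp add: DERIV_def flat_exp_def)
  qed
qed

lemma Ck_on_flat_exp: "Ck_on k UNIV (flat_exp n)"
proof (induction k arbitrary: n)
  case 0
  show ?case
    by (simp add: continuous_on_eq_continuous_at)
      (meson DERIV_isCont flat_exp_has_derivative)
next
  case (Suc k)
  show ?case
  proof (rule Ck_on_SucI)
    fix t show "(flat_exp n has_derivative
        (\<lambda>v. (flat_exp (n + 2) t + (- real n) * flat_exp (n + 1) t) * v)) (at t)"
      using flat_exp_has_derivative[of n t] by (simp add: has_field_derivative_def)
  next
    fix v :: real
    show "Ck_on k UNIV (\<lambda>t. (flat_exp (n + 2) t + (- real n) * flat_exp (n + 1) t) * v)"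
      by (intro Ck_on_mult Ck_on_add Ck_on_const Suc open_UNIV)
  qed auto
qed

lemma bump_function_euclidean:
  fixes a :: "'a::euclidean_space"
  assumes "r > 0"
  obtains h :: "'a \<Rightarrow> real" where "smooth_on UNIV h" "h a = 1" "\<And>x. x \<notin> cball a r \<Longrightarrow> h x = 0"
proof
  define h :: "'a \<Rightarrow> real"
    where "h x = flat_exp 0 (r\<^sup>2 + (- 1) * ((x - a) \<bullet> (x - a))) * inverse (flat_exp 0 (r\<^sup>2))" for x
  have comp: "Ck_on k UNIV (\<lambda>x::'a. (x - a) \<bullet> b)" for k b
  proof -
    have "Ck_on k UNIV (\<lambda>x::'a. x \<bullet> b + - (a \<bullet> b))"
      by (intro Ck_on_add Ck_on_const Ck_on_bounded_linear bounded_linear_inner_left open_UNIV)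
    then show ?thesis by (simp add: inner_diff_left)
  qed
  have "Ck_on k UNIV (\<lambda>x::'a. \<Sum>b\<in>Basis. ((x - a) \<bullet> b) * ((x - a) \<bullet> b))" for k
    by (intro Ck_on_sum Ck_on_mult comp open_UNIV)
  then have sq: "Ck_on k UNIV (\<lambda>x::'a. (x - a) \<bullet> (x - a))" for k
    by (simp only: euclidean_inner[symmetric])
  have "Ck_on k UNIV (\<lambda>x::'a. flat_exp 0 (r\<^sup>2 + (- 1) * ((x - a) \<bullet> (x - a))))" for k
    by (rule Ck_on_compose[where T = UNIV and f = "flat_exp 0",
          OF open_UNIV open_UNIV Ck_on_flat_exp Ck_on_add[OF open_UNIV Ck_on_const
            Ck_on_mult[OF open_UNIV Ck_on_const sq]]]) simp
  then show "smooth_on UNIV h"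
    unfolding smooth_on_def h_def by (intro allI Ck_on_mult Ck_on_const open_UNIV)
  show "h a = 1" using assms by (simp add: h_def flat_exp_def)
  show "h x = 0" if "x \<notin> cball a r" for x
  proof -
    have "r < norm (x - a)" using that by (simp add: dist_norm norm_minus_commute)
    then have "r\<^sup>2 < (norm (x - a))\<^sup>2" using assms by (intro power_strict_mono) auto
    then show ?thesis by (simp add: h_def flat_exp_def power2_norm_eq_inner)
  qed
qed

section \<open>The Hadamard lemma\<close>

text \<open>Differentiation under the integral in a direction \<open>v\<close> produces the factor \<open>t\<close> from the inner
  function \<open>x \<mapsto> a + t (x - a)\<close>. The weight \<open>t ^ n\<close> keeps the derivative within the same family of
  integrals.\<close>

lemma Ck_on_segment_integral:
  fixes F :: "'a::euclidean_space \<Rightarrow> real"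
  assumes "open S" "convex S" "a \<in> S" "Ck_on k S F"
  shows "Ck_on k S (\<lambda>x. integral (cbox 0 1) (\<lambda>t. t ^ n * F (a + t *\<^sub>R (x - a))))"
  using assms(4)
proof (induction k arbitrary: F n)
  have seg: "a + t *\<^sub>R (x - a) \<in> S" if "x \<in> S" "t \<in> cbox 0 1" for x and t :: real
  proof -
    have "a + t *\<^sub>R (x - a) = (1 - t) *\<^sub>R a + t *\<^sub>R x" by (simp add: algebra_simps)
    then show ?thesis using convexD[OF assms(2,3) that(1), of "1 - t" t] that(2) by auto
  qed
  {
    case 0
    have "continuous_on (S \<times> cbox (0::real) 1) (\<lambda>(x, t). t ^ n * F (a + t *\<^sub>R (x - a)))"
      unfolding split_beta
      by (intro continuous_intros continuous_on_compose2[OF 0[unfolded Ck_on.simps]])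
        (auto simp: seg simp del: cbox_interval)
    then show ?case unfolding Ck_on.simps by (rule integral_continuous_on_param)
  next
    case (Suc k)
    let ?D = "\<lambda>y. Blinfun (frechet_derivative F (at y))"
    define fx where "fx x t = (t ^ Suc n) *\<^sub>R ?D (a + t *\<^sub>R (x - a))" for x and t :: real
    have bl: "bounded_linear (frechet_derivative F (at y))" if "y \<in> S" for y
      using Ck_on_SucD[OF Suc.prems that] has_derivative_bounded_linear by blast
    have D: "blinfun_apply (?D y) = frechet_derivative F (at y)" if "y \<in> S" for y
      using bl[OF that] by (simp add: bounded_linear_Blinfun_apply)
    have contD: "continuous_on S ?D"
    proof (rule continuous_on_blinfun_componentwise)
      fix b
      have "continuous_on S (\<lambda>x. frechet_derivative F (at x) b)"
        using Suc.prems by (intro Ck_on_imp_continuous_on[of k]) simp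
      then show "continuous_on S (\<lambda>y. blinfun_apply (?D y) b)"
        by (rule continuous_on_eq) (simp add: D)
    qed
    have contF: "continuous_on S F"
      using Suc.prems by (rule Ck_on_imp_continuous_on)
    have cont_fx: "continuous_on (S \<times> cbox (0::real) 1) (\<lambda>(x, t). fx x t)"
      unfolding split_beta fx_def
      by (intro continuous_intros continuous_on_compose2[OF contD])
        (auto simp: seg simp del: cbox_interval)
    show ?case
    proof (rule Ck_on_SucI[OF \<open>open S\<close>])
      fix x assume x: "x \<in> S"
      have "((\<lambda>x. integral (cbox 0 1) (\<lambda>t. t ^ n * F (a + t *\<^sub>R (x - a)))) has_derivative
              integral (cbox 0 1) (fx x)) (at x within S)"
      proof (rule leibniz_rule[OF _ _ cont_fx x \<open>convex S\<close>])
        fix y t assume y: "y \<in> S" and t: "t \<in> cbox 0 (1::real)"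
        have "((\<lambda>y. a + t *\<^sub>R (y - a)) has_derivative (\<lambda>v. t *\<^sub>R v)) (at y)"
          by (auto intro!: derivative_eq_intros)
        from has_derivative_compose[OF this, of F, OF Ck_on_SucD[OF Suc.prems seg[OF y t]]]
        have "((\<lambda>y. t ^ n * F (a + t *\<^sub>R (y - a))) has_derivative
            (\<lambda>v. t ^ n * frechet_derivative F (at (a + t *\<^sub>R (y - a))) (t *\<^sub>R v))) (at y within S)"
          by (rule has_derivative_at_withinI[OF has_derivative_mult_right])
        moreover have "blinfun_apply (fx y t) =
            (\<lambda>v. t ^ n * frechet_derivative F (at (a + t *\<^sub>R (y - a))) (t *\<^sub>R v))"
          by (auto simp: fx_def scaleR_blinfun.rep_eq D[OF seg[OF y t]]
              linear_scale[OF bounded_linear.linear[OF bl[OF seg[OF y t]]]])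
        ultimately show "((\<lambda>y. t ^ n * F (a + t *\<^sub>R (y - a))) has_derivative blinfun_apply (fx y t))
            (at y within S)" by simp
      next
        fix y assume y: "y \<in> S"
        show "(\<lambda>t. t ^ n * F (a + t *\<^sub>R (y - a))) integrable_on cbox 0 1"
          by (intro integrable_continuous continuous_intros continuous_on_compose2[OF contF])
            (auto simp: seg[OF y] simp del: cbox_interval)
      qed
      then show "((\<lambda>x. integral (cbox 0 1) (\<lambda>t. t ^ n * F (a + t *\<^sub>R (x - a)))) has_derivative
              integral (cbox 0 1) (fx x)) (at x)"
        using at_within_open[OF x \<open>open S\<close>] by simp
    next
      fix v
      have "Ck_on k S (\<lambda>x. integral (cbox 0 1)
          (\<lambda>t. t ^ Suc n * frechet_derivative F (at (a + t *\<^sub>R (x - a))) v))"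
        using Suc.prems by (intro Suc.IH) auto
      then show "Ck_on k S (\<lambda>x. blinfun_apply (integral (cbox 0 1) (fx x)) v)"
      proof (rule Ck_on_cong[OF \<open>open S\<close>])
        fix x assume x: "x \<in> S"
        have "fx x integrable_on cbox 0 1"
          unfolding fx_def
          by (intro integrable_continuous continuous_intros continuous_on_compose2[OF contD])
            (auto simp: seg[OF x] simp del: cbox_interval)
        then have "blinfun_apply (integral (cbox 0 1) (fx x)) v =
            integral (cbox 0 1) (\<lambda>t. blinfun_apply (fx x t) v)"
          by (rule blinfun_apply_integral)
        also have "\<dots> = integral (cbox 0 1)
            (\<lambda>t. t ^ Suc n * frechet_derivative F (at (a + t *\<^sub>R (x - a))) v)"
          by (rule integral_cong) (simp add: fx_def scaleR_blinfun.rep_eq D[OF seg[OF x]])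
        finally show "integral (cbox 0 1)
            (\<lambda>t. t ^ Suc n * frechet_derivative F (at (a + t *\<^sub>R (x - a))) v) =
            blinfun_apply (integral (cbox 0 1) (fx x)) v" by simp
      qed
    qed
  }
qed

text \<open>The functions \<open>g b\<close> are the averages of the partial derivatives of \<open>f\<close> over the segment from \<open>a\<close>
  to \<open>x\<close>; the formula is the fundamental theorem of calculus on that segment.\<close>

lemma Hadamard:
  fixes f :: "'a::euclidean_space \<Rightarrow> real"
  assumes "open S" "convex S" "a \<in> S" "smooth_on S f"
  obtains g where "\<And>b. smooth_on S (g b)" "\<And>b. g b a = frechet_derivative f (at a) b"
    "\<And>x. x \<in> S \<Longrightarrow> f x = f a + (\<Sum>b\<in>Basis. ((x - a) \<bullet> b) * g b x)"
proof
  define g where "g b x = integral (cbox 0 1)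
      (\<lambda>t. t ^ 0 * frechet_derivative f (at (a + t *\<^sub>R (x - a))) b)" for b x
  have "Ck_on (Suc k) S f" for k using assms(4) by (auto simp: smooth_on_def simp del: Ck_on.simps)
  note f = this
  show "smooth_on S (g b)" for b
    unfolding smooth_on_def g_def
    using f by (intro allI Ck_on_segment_integral assms) auto
  show "g b a = frechet_derivative f (at a) b" for b by (simp add: g_def)
  fix x assume x: "x \<in> S"
  have seg: "a + t *\<^sub>R (x - a) \<in> S" if "t \<in> {0..1}" for t :: real
  proof -
    have "a + t *\<^sub>R (x - a) = (1 - t) *\<^sub>R a + t *\<^sub>R x" by (simp add: algebra_simps)
    then show ?thesis using convexD[OF assms(2,3) x, of "1 - t" t] that by auto
  qed
  let ?d = "\<lambda>t b. frechet_derivative f (at (a + t *\<^sub>R (x - a))) b"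
  have lin: "linear (?d t)" if "t \<in> {0..1}" for t
    using f seg[OF that] linear_frechet_derivative by (simp add: linear_frechet_derivative)
  have expand: "?d t (x - a) = (\<Sum>b\<in>Basis. ((x - a) \<bullet> b) * ?d t b)" if "t \<in> {0..1}" for t
  proof -
    have "?d t (x - a) = ?d t (\<Sum>b\<in>Basis. ((x - a) \<bullet> b) *\<^sub>R b)"
      by (simp add: euclidean_representation)
    then show ?thesis by (simp only: linear_sum[OF lin[OF that]] linear_scale[OF lin[OF that]] real_scaleR_def)
  qed
  have "((\<lambda>t. ?d t (x - a)) has_integral f (a + 1 *\<^sub>R (x - a)) - f (a + 0 *\<^sub>R (x - a))) {0..1}"
  proof (rule fundamental_theorem_of_calculus)
    fix t :: real assume t: "t \<in> {0..1}"
    have "((\<lambda>t. a + t *\<^sub>R (x - a)) has_derivative (\<lambda>s. s *\<^sub>R (x - a))) (at t)"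
      by (auto intro!: derivative_eq_intros)
    from has_derivative_compose[OF this, of f, OF Ck_on_SucD[OF f seg[OF t]]]
    have "((\<lambda>t. f (a + t *\<^sub>R (x - a))) has_derivative (\<lambda>s. ?d t (s *\<^sub>R (x - a))))
        (at t within {0..1})"
      by (rule has_derivative_at_withinI)
    then show "((\<lambda>t. f (a + t *\<^sub>R (x - a))) has_vector_derivative ?d t (x - a)) (at t within {0..1})"
      by (simp add: has_vector_derivative_def linear_scale[OF lin[OF t]])
  qed simp
  then have "f x - f a = integral {0..1} (\<lambda>t. ?d t (x - a))"
    by (simp add: integral_unique)
  also have "\<dots> = integral {0..1} (\<lambda>t. \<Sum>b\<in>Basis. ((x - a) \<bullet> b) * ?d t b)"
    by (rule integral_cong) (rule expand)
  also have "\<dots> = (\<Sum>b\<in>Basis. integral {0..1} (\<lambda>t. ((x - a) \<bullet> b) * ?d t b))"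
  proof (rule integral_sum)
    fix b :: 'a
    have "continuous_on S (\<lambda>y. frechet_derivative f (at y) b)"
      using f[of 0] by simp
    then have "continuous_on {0..1} (\<lambda>t. ?d t b)"
    proof (rule continuous_on_compose2)
      show "continuous_on {0..1} (\<lambda>t. a + t *\<^sub>R (x - a))" by (intro continuous_intros)
    qed (use seg in blast)
    then show "(\<lambda>t. ((x - a) \<bullet> b) * ?d t b) integrable_on {0..1}"
      by (intro integrable_continuous_interval continuous_on_mult_left)
  qed simp
  also have "\<dots> = (\<Sum>b\<in>Basis. ((x - a) \<bullet> b) * g b x)"
    by (simp add: g_def)
  finally show "f x = f a + (\<Sum>b\<in>Basis. ((x - a) \<bullet> b) * g b x)" by simp
qed

section \<open>Smooth functions and local frames on a manifold\<close>

text \<open>Smoothness on an open subset. It permits gluing: a function that is smooth on two open sets is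
  smooth on their union, whence extension by zero.\<close>

definition smooth_fun_on :: "('a, 'e::euclidean_space) atlas \<Rightarrow> 'a set \<Rightarrow> ('a \<Rightarrow> real) \<Rightarrow> bool" where
  "smooth_fun_on A V f \<longleftrightarrow> (\<forall>(U, \<kappa>)\<in>A. smooth_on (\<kappa> ` (U \<inter> V)) (f \<circ> inv_into U \<kappa>))"

lemma smooth_functions_iff: "f \<in> smooth_functions A \<longleftrightarrow> smooth_fun_on A UNIV f"
  by (simp add: smooth_functions_def smooth_fun_on_def)

lemma chart_homeomorphism:
  assumes "smooth_manifold A" "(U, \<kappa>) \<in> A"
  shows "open U" "open (\<kappa> ` U)" "homeomorphism U (\<kappa> ` U) \<kappa> (inv_into U \<kappa>)"
  using assms by (auto simp: smooth_manifold_def)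

lemma chart_inverse:
  assumes "smooth_manifold A" "(U, \<kappa>) \<in> A" "x \<in> U"
  shows "inv_into U \<kappa> (\<kappa> x) = x"
  using homeomorphism_apply1[OF chart_homeomorphism(3)[OF assms(1,2)] assms(3)] .

lemma open_chart_image:
  assumes "smooth_manifold A" "(U, \<kappa>) \<in> A" "open V"
  shows "open (\<kappa> ` (U \<inter> V))"
  using homeomorphism_imp_open_map[OF chart_homeomorphism(3)[OF assms(1,2)], of "U \<inter> V"]
    chart_homeomorphism(2)[OF assms(1,2)] assms(3)
  by (simp add: openin_open_Int openin_open_eq)

lemma open_chart_preimage:
  assumes "smooth_manifold A" "(U, \<kappa>) \<in> A" "open S" "S \<subseteq> \<kappa> ` U"
  shows "open (inv_into U \<kappa> ` S)"
  using homeomorphism_imp_open_map[OF homeomorphism_symD[OF chart_homeomorphism(3)[OF assms(1,2)]], of S]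
    chart_homeomorphism(1)[OF assms(1,2)] assms(3,4)
  by (simp add: openin_open_eq open_subset)

lemma smooth_fun_on_subset: "smooth_fun_on A V f \<Longrightarrow> W \<subseteq> V \<Longrightarrow> smooth_fun_on A W f"
  unfolding smooth_fun_on_def smooth_on_def
  by (blast intro: Ck_on_subset)

lemma smooth_fun_on_cong:
  assumes "smooth_manifold A" "open V" "smooth_fun_on A V f" "\<And>x. x \<in> V \<Longrightarrow> f x = g x"
  shows "smooth_fun_on A V g"
  unfolding smooth_fun_on_def smooth_on_def
proof (clarify)
  fix U and \<kappa> :: "'a \<Rightarrow> 'b" and k assume chart: "(U, \<kappa>) \<in> A"
  have "Ck_on k (\<kappa> ` (U \<inter> V)) (f \<circ> inv_into U \<kappa>)"
    using assms(3) chart unfolding smooth_fun_on_def smooth_on_def by blast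
  then show "Ck_on k (\<kappa> ` (U \<inter> V)) (g \<circ> inv_into U \<kappa>)"
    by (rule Ck_on_cong[OF open_chart_image[OF assms(1) chart assms(2)]])
       (auto simp: chart_inverse[OF assms(1) chart] assms(4))
qed

lemma smooth_fun_on_Un:
  assumes "smooth_manifold A" "open V" "open W" "smooth_fun_on A V f" "smooth_fun_on A W f"
  shows "smooth_fun_on A (V \<union> W) f"
  unfolding smooth_fun_on_def smooth_on_def
proof (clarify)
  fix U and \<kappa> :: "'a \<Rightarrow> 'b" and k assume chart: "(U, \<kappa>) \<in> A"
  have "Ck_on k (\<kappa> ` (U \<inter> V)) (f \<circ> inv_into U \<kappa>)" "Ck_on k (\<kappa> ` (U \<inter> W)) (f \<circ> inv_into U \<kappa>)"
    using assms(4,5) chart unfolding smooth_fun_on_def smooth_on_def by blast+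
  moreover have "open (\<kappa> ` (U \<inter> V))" "open (\<kappa> ` (U \<inter> W))"
    using open_chart_image[OF assms(1) chart] assms(2,3) by auto
  ultimately show "Ck_on k (\<kappa> ` (U \<inter> (V \<union> W))) (f \<circ> inv_into U \<kappa>)"
    by (intro Ck_on_locally) blast
qed

text \<open>A function need only be smooth in one chart; the other charts follow by composition with the
  transition maps.\<close>

lemma smooth_fun_on_chart:
  fixes A :: "('a::{t2_space,second_countable_topology}, 'e::euclidean_space) atlas"
  assumes M: "smooth_manifold A" and chart: "(U, \<kappa>) \<in> A" and V: "open V" "V \<subseteq> U"
    and F: "smooth_on (\<kappa> ` V) F"
  shows "smooth_fun_on A V (F \<circ> \<kappa>)"
  unfolding smooth_fun_on_def smooth_on_def
proof (clarify)
  fix U' and \<kappa>' :: "'a \<Rightarrow> 'e" and k assume chart': "(U', \<kappa>') \<in> A"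
  have "smooth_on (\<kappa>' ` (U' \<inter> U)) (\<kappa> \<circ> inv_into U' \<kappa>')"
    using M chart chart' unfolding smooth_manifold_def by blast
  then have "Ck_on k (\<kappa>' ` (U' \<inter> V)) (\<lambda>x. (\<kappa> \<circ> inv_into U' \<kappa>') x)"
    using V(2) unfolding smooth_on_def o_def by (blast intro: Ck_on_subset)
  moreover have "open (\<kappa> ` V)"
    using open_chart_image[OF M chart V(1)] V(2) by (simp add: Int_absorb1)
  moreover have "Ck_on k (\<kappa> ` V) F" using F by (simp add: smooth_on_def)
  moreover have "(\<lambda>x. (\<kappa> \<circ> inv_into U' \<kappa>') x) ` (\<kappa>' ` (U' \<inter> V)) \<subseteq> \<kappa> ` V"
    using chart_inverse[OF M chart'] by auto
  ultimately have "Ck_on k (\<kappa>' ` (U' \<inter> V)) (\<lambda>x. F ((\<kappa> \<circ> inv_into U' \<kappa>') x))"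
    using Ck_on_compose[OF open_chart_image[OF M chart' V(1)]] by metis
  then show "Ck_on k (\<kappa>' ` (U' \<inter> V)) (F \<circ> \<kappa> \<circ> inv_into U' \<kappa>')"
    by (simp add: o_def)
qed

lemma smooth_fun_on_const: "smooth_fun_on A V (\<lambda>x. c)"
  by (auto simp: smooth_fun_on_def smooth_on_def o_def Ck_on_const)

lemma smooth_fun_on_add:
  assumes "smooth_manifold A" "open V" "smooth_fun_on A V f" "smooth_fun_on A V g"
  shows "smooth_fun_on A V (\<lambda>x. f x + g x)"
  using assms(3,4) open_chart_image[OF assms(1) _ assms(2)]
  unfolding smooth_fun_on_def smooth_on_def o_def by (fast intro: Ck_on_add)

lemma smooth_fun_on_mult:
  assumes "smooth_manifold A" "open V" "smooth_fun_on A V f" "smooth_fun_on A V g"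
  shows "smooth_fun_on A V (\<lambda>x. f x * g x)"
  using assms(3,4) open_chart_image[OF assms(1) _ assms(2)]
  unfolding smooth_fun_on_def smooth_on_def o_def by (fast intro: Ck_on_mult)

lemma smooth_const: "(\<lambda>x. c) \<in> smooth_functions A"
  by (simp add: smooth_functions_iff smooth_fun_on_const)

lemma smooth_add:
  "smooth_manifold A \<Longrightarrow> f \<in> smooth_functions A \<Longrightarrow> g \<in> smooth_functions A \<Longrightarrow>
    (\<lambda>x. f x + g x) \<in> smooth_functions A"
  by (simp add: smooth_functions_iff smooth_fun_on_add)

lemma smooth_mult:
  "smooth_manifold A \<Longrightarrow> f \<in> smooth_functions A \<Longrightarrow> g \<in> smooth_functions A \<Longrightarrow>
    (\<lambda>x. f x * g x) \<in> smooth_functions A"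
  by (simp add: smooth_functions_iff smooth_fun_on_mult)

lemma smooth_diff:
  "smooth_manifold A \<Longrightarrow> f \<in> smooth_functions A \<Longrightarrow> g \<in> smooth_functions A \<Longrightarrow>
    (\<lambda>x. f x - g x) \<in> smooth_functions A"
  using smooth_add[of A f "\<lambda>x. (- 1) * g x"] smooth_mult[of A "\<lambda>x. - 1" g]
  by (simp add: smooth_const)

lemma smooth_sum:
  "smooth_manifold A \<Longrightarrow> (\<And>i. i \<in> I \<Longrightarrow> f i \<in> smooth_functions A) \<Longrightarrow>
    (\<lambda>x. \<Sum>i\<in>I. f i x) \<in> smooth_functions A"
  by (induction I rule: infinite_finite_induct) (auto intro: smooth_const smooth_add)

lemma smooth_extension_by_zero:
  assumes "smooth_manifold A" "open V" "closed K" "K \<subseteq> V" "smooth_fun_on A V f"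
    and "\<And>x. x \<notin> K \<Longrightarrow> f x = 0"
  shows "f \<in> smooth_functions A"
proof -
  have "smooth_fun_on A (- K) f"
    by (rule smooth_fun_on_cong[OF assms(1) _ smooth_fun_on_const[of A _ 0]])
      (use assms(3,6) in auto)
  then have "smooth_fun_on A (V \<union> - K) f"
    using assms by (intro smooth_fun_on_Un) auto
  moreover have "V \<union> - K = UNIV" using assms(4) by auto
  ultimately show ?thesis by (simp add: smooth_functions_iff)
qed

lemma smooth_extension_of_product:
  assumes "smooth_manifold A" "open V" "closed K" "K \<subseteq> V"
    and "\<omega> \<in> smooth_functions A" "\<And>x. x \<notin> K \<Longrightarrow> \<omega> x = 0" "smooth_fun_on A V h"
  shows "(\<lambda>x. if x \<in> V then \<omega> x * h x else 0) \<in> smooth_functions A"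
proof (rule smooth_extension_by_zero[OF assms(1-4)])
  have "smooth_fun_on A V (\<lambda>x. \<omega> x * h x)"
    using assms by (intro smooth_fun_on_mult) (auto simp: smooth_functions_iff intro: smooth_fun_on_subset)
  then show "smooth_fun_on A V (\<lambda>x. if x \<in> V then \<omega> x * h x else 0)"
    by (rule smooth_fun_on_cong[OF assms(1,2)]) simp
qed (use assms(6) in auto)

text \<open>The support \<open>K\<close> is the inverse image of a closed ball in the chart. It is compact and hence closed
  in the whole manifold, because the manifold is Hausdorff; this allows extension by zero.\<close>

lemma bump_function_chart:
  fixes A :: "('a::{t2_space,second_countable_topology}, 'e::euclidean_space) atlas"
  assumes M: "smooth_manifold A" and chart: "(U, \<kappa>) \<in> A" and W: "open W" "W \<subseteq> U" "p \<in> W"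
  obtains \<omega> K where "\<omega> \<in> smooth_functions A" "closed K" "K \<subseteq> W" "\<omega> p = 1"
    "\<And>x. x \<notin> K \<Longrightarrow> \<omega> x = 0"
proof -
  have "open (\<kappa> ` W)" using open_chart_image[OF M chart W(1)] W(2) by (simp add: Int_absorb1)
  then obtain r where r: "r > 0" "cball (\<kappa> p) r \<subseteq> \<kappa> ` W"
    using W(3) open_contains_cball by (metis imageI)
  obtain h :: "'e \<Rightarrow> real" where h: "smooth_on UNIV h" "h (\<kappa> p) = 1"
      "\<And>x. x \<notin> cball (\<kappa> p) r \<Longrightarrow> h x = 0"
    using bump_function_euclidean[OF r(1), of "\<kappa> p"] by blast
  define K where "K = inv_into U \<kappa> ` cball (\<kappa> p) r"
  define \<omega> where "\<omega> x = (if x \<in> W then h (\<kappa> x) else 0)" for x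
  have "continuous_on (cball (\<kappa> p) r) (inv_into U \<kappa>)"
    using homeomorphism_cont2[OF chart_homeomorphism(3)[OF M chart]] r(2) W(2)
    by (blast intro: continuous_on_subset)
  then have K: "closed K"
    unfolding K_def by (intro compact_imp_closed compact_continuous_image) auto
  have KW: "K \<subseteq> W"
    using r(2) W(2) chart_inverse[OF M chart] by (force simp: K_def)
  have 0: "\<omega> x = 0" if "x \<notin> K" for x
  proof (cases "x \<in> W")
    case True
    then have "\<kappa> x \<notin> cball (\<kappa> p) r"
      using that W(2) chart_inverse[OF M chart, of x] unfolding K_def by (metis imageI subsetD)
    then show ?thesis by (simp add: \<omega>_def h(3))
  qed (simp add: \<omega>_def)
  have "smooth_fun_on A W (h \<circ> \<kappa>)"
    using h(1) by (intro smooth_fun_on_chart[OF M chart W(1,2)])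
      (auto simp: smooth_on_def intro: Ck_on_subset)
  then have "smooth_fun_on A W \<omega>"
    by (rule smooth_fun_on_cong[OF M W(1)]) (simp add: \<omega>_def)
  then have "\<omega> \<in> smooth_functions A"
    by (rule smooth_extension_by_zero[OF M W(1) K KW _ 0])
  moreover have "\<omega> p = 1" using W(3) h(2) by (simp add: \<omega>_def)
  ultimately show thesis using that K KW 0 by blast
qed

lemma tangent_lincomb:
  "v \<in> tangent_space A p \<Longrightarrow> f \<in> smooth_functions A \<Longrightarrow> g \<in> smooth_functions A \<Longrightarrow>
    v (\<lambda>x. a * f x + b * g x) = a * v f + b * v g"
  by (simp add: tangent_space_def)

lemma tangent_mult:
  "v \<in> tangent_space A p \<Longrightarrow> f \<in> smooth_functions A \<Longrightarrow> g \<in> smooth_functions A \<Longrightarrow>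
    v (\<lambda>x. f x * g x) = f p * v g + g p * v f"
  by (simp add: tangent_space_def)

lemma tangent_nonsmooth:
  "v \<in> tangent_space A p \<Longrightarrow> f \<notin> smooth_functions A \<Longrightarrow> v f = 0"
  by (simp add: tangent_space_def)

lemma tangent_const:
  assumes "v \<in> tangent_space A p"
  shows "v (\<lambda>x. c) = 0"
proof -
  have one: "v (\<lambda>x. 1) = 0"
    using tangent_mult[OF assms smooth_const smooth_const, of 1 1] by simp
  show ?thesis using tangent_lincomb[OF assms smooth_const smooth_const, of c 1 0 1] one by simp
qed

lemma tangent_add:
  "v \<in> tangent_space A p \<Longrightarrow> f \<in> smooth_functions A \<Longrightarrow> g \<in> smooth_functions A \<Longrightarrow>
    v (\<lambda>x. f x + g x) = v f + v g"
  using tangent_lincomb[of v A p f g 1 1] by simp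

lemma tangent_diff:
  "v \<in> tangent_space A p \<Longrightarrow> f \<in> smooth_functions A \<Longrightarrow> g \<in> smooth_functions A \<Longrightarrow>
    v (\<lambda>x. f x - g x) = v f - v g"
  using tangent_lincomb[of v A p f g 1 "- 1"] by simp

lemma tangent_sum:
  assumes "smooth_manifold A" "v \<in> tangent_space A p" "finite I"
    and "\<And>i. i \<in> I \<Longrightarrow> f i \<in> smooth_functions A"
  shows "v (\<lambda>x. \<Sum>i\<in>I. f i x) = (\<Sum>i\<in>I. v (f i))"
  using assms(3,4)
  by (induction I rule: finite_induct)
    (simp_all add: tangent_const[OF assms(2)] tangent_add[OF assms(2) _ smooth_sum[OF assms(1)]])

text \<open>The field \<open>\<eta> \<partial>\<^sub>b\<close> for a direction \<open>b\<close> of the chart, extended by zero outside the domain of the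
  chart. It is meant for \<open>\<eta>\<close> supported in that domain.\<close>

definition coordinate_field ::
  "('a, 'e::euclidean_space) atlas \<Rightarrow> 'a set \<Rightarrow> ('a \<Rightarrow> 'e) \<Rightarrow> ('a \<Rightarrow> real) \<Rightarrow> 'e \<Rightarrow> 'a vfield" where
  "coordinate_field A U \<kappa> \<eta> b = (\<lambda>q f.
     if q \<in> U \<and> f \<in> smooth_functions A then \<eta> q * frechet_derivative (f \<circ> inv_into U \<kappa>) (at (\<kappa> q)) b
     else 0)"

lemma smooth_function_in_chart:
  assumes "(U, \<kappa>) \<in> A" "f \<in> smooth_functions A"
  shows "smooth_on (\<kappa> ` U) (f \<circ> inv_into U \<kappa>)"
  using assms by (auto simp: smooth_functions_def)

lemma has_derivative_in_chart:
  assumes "(U, \<kappa>) \<in> A" "f \<in> smooth_functions A" "q \<in> U"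
  shows "(f \<circ> inv_into U \<kappa> has_derivative frechet_derivative (f \<circ> inv_into U \<kappa>) (at (\<kappa> q))) (at (\<kappa> q))"
proof (rule Ck_on_SucD)
  show "Ck_on (Suc 0) (\<kappa> ` U) (f \<circ> inv_into U \<kappa>)"
    using smooth_function_in_chart[OF assms(1,2)] unfolding smooth_on_def by blast
qed (use assms(3) in blast)

lemma coordinate_field_in_vector_fields:
  fixes A :: "('a::{t2_space,second_countable_topology}, 'e::euclidean_space) atlas"
  assumes M: "smooth_manifold A" and chart: "(U, \<kappa>) \<in> A" and K: "closed K" "K \<subseteq> U"
    and \<eta>: "\<eta> \<in> smooth_functions A" "\<And>x. x \<notin> K \<Longrightarrow> \<eta> x = 0"
  shows "coordinate_field A U \<kappa> \<eta> b \<in> vector_fields A"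
  unfolding vector_fields_def mem_Collect_eq
proof (intro conjI allI ballI)
  fix p
  note D = has_derivative_in_chart[OF chart]
  show "coordinate_field A U \<kappa> \<eta> b p \<in> tangent_space A p"
  proof (cases "p \<in> U")
    case True
    have "frechet_derivative ((\<lambda>x. s * f x + t * g x) \<circ> inv_into U \<kappa>) (at (\<kappa> p)) =
        (\<lambda>h. s * frechet_derivative (f \<circ> inv_into U \<kappa>) (at (\<kappa> p)) h
           + t * frechet_derivative (g \<circ> inv_into U \<kappa>) (at (\<kappa> p)) h)"
      if "f \<in> smooth_functions A" "g \<in> smooth_functions A" for f g s t
      using has_derivative_add[OF has_derivative_mult_right[OF D[OF that(1) True], of s]
          has_derivative_mult_right[OF D[OF that(2) True], of t]]
      by (intro frechet_derivative_at[symmetric]) (simp add: o_def)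
    moreover have "frechet_derivative ((\<lambda>x. f x * g x) \<circ> inv_into U \<kappa>) (at (\<kappa> p)) =
        (\<lambda>h. f p * frechet_derivative (g \<circ> inv_into U \<kappa>) (at (\<kappa> p)) h
           + frechet_derivative (f \<circ> inv_into U \<kappa>) (at (\<kappa> p)) h * g p)"
      if "f \<in> smooth_functions A" "g \<in> smooth_functions A" for f g
      using has_derivative_mult[OF D[OF that(1) True] D[OF that(2) True]] chart_inverse[OF M chart True]
      by (intro frechet_derivative_at[symmetric]) (simp add: o_def)
    moreover have "(\<lambda>x. s * f x + t * g x) \<in> smooth_functions A" "(\<lambda>x. f x * g x) \<in> smooth_functions A"
      if "f \<in> smooth_functions A" "g \<in> smooth_functions A" for f g and s t :: real
      using that by (auto intro!: smooth_add smooth_mult M smooth_const)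
    ultimately show ?thesis
      using True by (simp add: tangent_space_def coordinate_field_def algebra_simps)
  qed (simp add: tangent_space_def coordinate_field_def)
next
  fix f assume f: "f \<in> smooth_functions A"
  let ?d = "\<lambda>y. frechet_derivative (f \<circ> inv_into U \<kappa>) (at y) b"
  have "Ck_on (Suc k) (\<kappa> ` U) (f \<circ> inv_into U \<kappa>)" for k
    using smooth_function_in_chart[OF chart f] unfolding smooth_on_def by blast
  then have "smooth_on (\<kappa> ` U) ?d"
    unfolding smooth_on_def by simp
  then have "smooth_fun_on A U (?d \<circ> \<kappa>)"
    by (intro smooth_fun_on_chart[OF M chart]) (auto simp: chart_homeomorphism[OF M chart])
  from smooth_extension_of_product[OF M chart_homeomorphism(1)[OF M chart] K \<eta> this]
  show "(\<lambda>p. coordinate_field A U \<kappa> \<eta> b p f) \<in> smooth_functions A"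
    using f by (simp add: coordinate_field_def cong: if_cong)
qed

text \<open>Morally this is \<open>v f = (\<Sum>b. v(\<kappa>\<^sub>b) \<partial>\<^sub>b f)\<close> multiplied by the cutoff \<open>\<beta>\<close> at \<open>q\<close>. The coordinate \<open>\<kappa>\<^sub>b\<close> is
  not globally defined; it is replaced by \<open>\<xi> b = \<beta> \<kappa>\<^sub>b\<close>, and the product rule turns \<open>\<beta>(q) v(\<kappa>\<^sub>b)\<close> into
  \<open>v (\<xi> b) - \<kappa>\<^sub>b(q) v \<beta>\<close>. The proof multiplies the Hadamard expansion of \<open>f\<close> at \<open>q\<close> by \<open>\<beta>\<close> and a bump
  function \<open>\<psi>\<close> and applies \<open>v\<close>.\<close>

lemma tangent_vector_in_chart:
  fixes A :: "('a::{t2_space,second_countable_topology}, 'e::euclidean_space) atlas"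
  assumes M: "smooth_manifold A" and chart: "(U, \<kappa>) \<in> A" and q: "q \<in> U"
    and \<beta>: "\<beta> \<in> smooth_functions A"
    and \<xi>: "\<And>b. \<xi> b \<in> smooth_functions A" "\<And>b x. x \<in> U \<Longrightarrow> \<xi> b x = \<beta> x * (\<kappa> x \<bullet> b)"
    and v: "v \<in> tangent_space A q" and f: "f \<in> smooth_functions A"
  shows "\<beta> q * v f = (\<Sum>b\<in>Basis. (v (\<xi> b) - (\<kappa> q \<bullet> b) * v \<beta>) *
           frechet_derivative (f \<circ> inv_into U \<kappa>) (at (\<kappa> q)) b)"
proof -
  let ?F = "f \<circ> inv_into U \<kappa>"
  obtain r where r: "r > 0" "ball (\<kappa> q) r \<subseteq> \<kappa> ` U"
    using chart_homeomorphism(2)[OF M chart] q open_contains_ball by (metis imageI)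
  define S where "S = ball (\<kappa> q) r"
  define V where "V = inv_into U \<kappa> ` S"
  have V: "open V" "V \<subseteq> U" "q \<in> V"
    using r q chart_inverse[OF M chart]
    by (auto simp: V_def S_def intro!: open_chart_preimage[OF M chart] image_eqI[of q _ "\<kappa> q"])
  have \<kappa>V: "\<kappa> ` V = S"
    using r chart_inverse[OF M chart] homeomorphism_apply2[OF chart_homeomorphism(3)[OF M chart]]
    by (force simp: V_def S_def image_image)
  have "smooth_on S ?F"
    using smooth_function_in_chart[OF chart f] r(2) unfolding smooth_on_def S_def
    by (blast intro: Ck_on_subset)
  then obtain g where g: "\<And>b. smooth_on S (g b)" "\<And>b. g b (\<kappa> q) = frechet_derivative ?F (at (\<kappa> q)) b"
      "\<And>x. x \<in> S \<Longrightarrow> ?F x = ?F (\<kappa> q) + (\<Sum>b\<in>Basis. ((x - \<kappa> q) \<bullet> b) * g b x)"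
    using Hadamard[of S "\<kappa> q" ?F] r(1) by (auto simp: S_def)
  obtain \<psi> K where \<psi>: "\<psi> \<in> smooth_functions A" "closed K" "K \<subseteq> V" "\<psi> q = 1"
      "\<And>x. x \<notin> K \<Longrightarrow> \<psi> x = 0"
    using bump_function_chart[OF M chart V] by blast
  define G where "G b x = (if x \<in> V then \<psi> x * (g b \<circ> \<kappa>) x else 0)" for b x
  have G: "G b \<in> smooth_functions A" for b
    unfolding G_def using g(1) \<kappa>V
    by (intro smooth_extension_of_product[OF M V(1) \<psi>(2,3,1,5)] smooth_fun_on_chart[OF M chart V(1,2)]) auto
  have Gq: "G b q = frechet_derivative ?F (at (\<kappa> q)) b" for b
    using V(3) \<psi>(4) g(2) by (simp add: G_def)
  let ?H = "\<lambda>b x. \<xi> b x - (\<kappa> q \<bullet> b) * \<beta> x"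
  have H: "?H b \<in> smooth_functions A" for b
    using \<xi>(1) \<beta> by (intro smooth_diff smooth_mult M smooth_const)
  \<comment> \<open>This holds globally: outside \<open>V\<close> both sides are zero. Each factor \<open>?H b\<close> vanishes at \<open>q\<close>.\<close>
  have eq: "(\<psi> x * \<beta> x) * (f x - f q) = (\<Sum>b\<in>Basis. ?H b x * G b x)" for x
  proof (cases "x \<in> V")
    case True
    then have x: "x \<in> U" "\<kappa> x \<in> S" using V(2) \<kappa>V by auto
    have "f x - f q = (\<Sum>b\<in>Basis. ((\<kappa> x - \<kappa> q) \<bullet> b) * g b (\<kappa> x))"
      using g(3)[OF x(2)] chart_inverse[OF M chart] x(1) q by simp
    then show ?thesis
      using True x(1)
      by (simp add: sum_distrib_left G_def \<xi>(2) inner_diff_left algebra_simps)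
  next
    case False
    then show ?thesis using \<psi>(3,5) by (auto simp: G_def)
  qed
  have "v (\<lambda>x. (\<psi> x * \<beta> x) * (f x - f q)) = \<beta> q * v f"
    using tangent_mult[OF v smooth_mult[OF M \<psi>(1) \<beta>] smooth_diff[OF M f smooth_const[of "f q"]]]
      tangent_diff[OF v f smooth_const[of "f q"]] tangent_const[OF v] \<psi>(4) by simp
  moreover have "v (\<lambda>x. \<Sum>b\<in>Basis. ?H b x * G b x) = (\<Sum>b\<in>Basis. v (\<lambda>x. ?H b x * G b x))"
    by (rule tangent_sum[OF M v finite_Basis smooth_mult[OF M H G]])
  moreover have "v (\<lambda>x. ?H b x * G b x) = (v (\<xi> b) - (\<kappa> q \<bullet> b) * v \<beta>) * G b q" for b
  proof -
    have "v (?H b) = v (\<xi> b) - (\<kappa> q \<bullet> b) * v \<beta>"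
      using tangent_diff[OF v \<xi>(1) smooth_mult[OF M smooth_const \<beta>]]
        tangent_lincomb[OF v \<beta> \<beta>, of _ 0] by simp
    then show ?thesis
      using tangent_mult[OF v H G, of b b] \<xi>(2)[OF q] by simp
  qed
  ultimately show ?thesis using Gq by (simp add: eq)
qed

text \<open>Multiplying the formula of \<open>tangent_vector_in_chart\<close> by \<open>\<beta>\<close> gives
  \<open>\<beta>\<^sup>2 v = (\<Sum>b. v (\<beta> \<kappa>\<^sub>b) \<beta> \<partial>\<^sub>b - v \<beta> (\<beta> \<kappa>\<^sub>b) \<partial>\<^sub>b)\<close>, in which every function and every field is global. This is
  why the index set consists of two copies of the basis and why \<open>\<rho> = \<beta>\<^sup>2\<close>.\<close>

lemma local_frame:
  fixes A :: "('a::{t2_space,second_countable_topology}, 'e::euclidean_space) atlas"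
  assumes M: "smooth_manifold A"
  obtains \<rho> and I :: "('e \<times> bool) set" and \<xi> E where "\<rho> \<in> smooth_functions A" "\<rho> p = 1" "finite I"
    "\<And>i. i \<in> I \<Longrightarrow> \<xi> i \<in> smooth_functions A" "\<And>i. i \<in> I \<Longrightarrow> E i \<in> vector_fields A"
    "\<And>q v f. v \<in> tangent_space A q \<Longrightarrow> \<rho> q * v f = (\<Sum>i\<in>I. v (\<xi> i) * E i q f)"
proof -
  obtain U \<kappa> where chart: "(U, \<kappa>) \<in> A" "p \<in> U"
  proof -
    have "p \<in> (\<Union>(U, \<kappa>)\<in>A. U)" using M unfolding smooth_manifold_def by blast
    then show thesis using that by auto
  qed
  note U = chart_homeomorphism(1)[OF M chart(1)]
  obtain \<beta> K where \<beta>: "\<beta> \<in> smooth_functions A" "closed K" "K \<subseteq> U" "\<beta> p = 1" "\<And>x. x \<notin> K \<Longrightarrow> \<beta> x = 0"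
    using bump_function_chart[OF M chart(1) U order_refl chart(2)] by blast
  define x where "x b q = (if q \<in> U then \<beta> q * ((\<lambda>y. y \<bullet> b) \<circ> \<kappa>) q else 0)" for b q
  have x: "x b \<in> smooth_functions A" for b
    unfolding x_def
    by (intro smooth_extension_of_product[OF M U \<beta>(2,3,1,5)] smooth_fun_on_chart[OF M chart(1) U])
      (auto simp: smooth_on_def intro: Ck_on_bounded_linear bounded_linear_inner_left
        chart_homeomorphism(2)[OF M chart(1)])
  have x0: "x b q = 0" if "q \<notin> K" for b q using \<beta>(5)[OF that] by (simp add: x_def)
  \<comment> \<open>The flag selects between the pairs \<open>(\<beta> \<kappa>\<^sub>b, \<beta> \<partial>\<^sub>b)\<close> and \<open>(\<beta>, - \<beta> \<kappa>\<^sub>b \<partial>\<^sub>b)\<close>.\<close>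
  define \<xi> where "\<xi> = (\<lambda>(b, c). if c then x b else \<beta>)"
  define \<eta> where "\<eta> = (\<lambda>(b, c). if c then \<beta> else (\<lambda>q. (- 1) * x b q))"
  define E where "E i = coordinate_field A U \<kappa> (\<eta> i) (fst i)" for i
  have \<eta>: "\<eta> i \<in> smooth_functions A" "\<And>q. q \<notin> K \<Longrightarrow> \<eta> i q = 0" for i
    using x \<beta> x0 smooth_mult[OF M smooth_const[of "- 1"] x] by (auto simp: \<eta>_def split: prod.split)
  show thesis
  proof (rule that[of "\<lambda>q. \<beta> q * \<beta> q" "Basis \<times> UNIV" \<xi> E])
    show "(\<lambda>q. \<beta> q * \<beta> q) \<in> smooth_functions A" by (intro smooth_mult M \<beta>)
    show "\<xi> i \<in> smooth_functions A" for i using x \<beta> by (auto simp: \<xi>_def split: prod.split)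
    show "E i \<in> vector_fields A" for i
      unfolding E_def by (rule coordinate_field_in_vector_fields[OF M chart(1) \<beta>(2,3) \<eta>])
    fix q v f assume v: "v \<in> tangent_space A q"
    consider "f \<notin> smooth_functions A" | "q \<notin> U" | "f \<in> smooth_functions A" "q \<in> U" by blast
    then show "\<beta> q * \<beta> q * v f = (\<Sum>i\<in>Basis \<times> UNIV. v (\<xi> i) * E i q f)"
    proof cases
      case 1
      then show ?thesis using tangent_nonsmooth[OF v] by (simp add: E_def coordinate_field_def)
    next
      case 2
      then show ?thesis using \<beta>(3,5) by (auto simp: E_def coordinate_field_def)
    next
      case 3
      let ?d = "\<lambda>b. frechet_derivative (f \<circ> inv_into U \<kappa>) (at (\<kappa> q)) b"
      have "(\<Sum>i\<in>Basis \<times> UNIV. v (\<xi> i) * E i q f) =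
          (\<Sum>b\<in>Basis. \<Sum>c\<in>UNIV. v (\<xi> (b, c)) * E (b, c) q f)"
        by (simp add: sum.cartesian_product split_beta)
      also have "\<dots> = (\<Sum>b\<in>Basis. v (x b) * (\<beta> q * ?d b) - v \<beta> * (x b q * ?d b))"
        using 3 by (simp add: UNIV_bool E_def coordinate_field_def \<xi>_def \<eta>_def algebra_simps)
      also have "\<dots> = \<beta> q * (\<Sum>b\<in>Basis. (v (x b) - (\<kappa> q \<bullet> b) * v \<beta>) * ?d b)"
        using 3 by (simp add: sum_distrib_left x_def algebra_simps)
      also have "\<dots> = \<beta> q * (\<beta> q * v f)"
        using tangent_vector_in_chart[OF M chart(1) 3(2) \<beta>(1), of x, OF x _ v 3(1)] by (simp add: x_def)
      finally show ?thesis by simp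
    qed
  qed (use \<beta> in auto)
qed

section \<open>Tensor fields as multilinear maps on vector fields\<close>

lemma tangent_space_lincomb:
  assumes "u \<in> tangent_space A p" "w \<in> tangent_space A p"
  shows "(\<lambda>f. a * u f + b * w f) \<in> tangent_space A p"
  using assms by (simp add: tangent_space_def algebra_simps)

lemma vector_field_tangent: "X \<in> vector_fields A \<Longrightarrow> X p \<in> tangent_space A p"
  by (simp add: vector_fields_def)

lemma vector_field_smooth:
  "X \<in> vector_fields A \<Longrightarrow> f \<in> smooth_functions A \<Longrightarrow> (\<lambda>p. X p f) \<in> smooth_functions A"
  by (simp add: vector_fields_def)

lemma vector_field_nonsmooth: "X \<in> vector_fields A \<Longrightarrow> f \<notin> smooth_functions A \<Longrightarrow> X p f = 0"
  using tangent_nonsmooth[OF vector_field_tangent] .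

lemma vector_field_eqI:
  assumes "X \<in> vector_fields A" "Y \<in> vector_fields A"
    and "\<And>p f. f \<in> smooth_functions A \<Longrightarrow> X p f = Y p f"
  shows "X = Y"
proof (intro ext)
  show "X p f = Y p f" for p f
    using assms vector_field_nonsmooth[of X A f p] vector_field_nonsmooth[of Y A f p] by (cases "f \<in> smooth_functions A") auto
qed

lemma scale_field_in_vector_fields:
  assumes "smooth_manifold A" "g \<in> smooth_functions A" "X \<in> vector_fields A"
  shows "scale_field g X \<in> vector_fields A"
  using assms smooth_mult[OF assms(1,2)] tangent_space_lincomb[of "X p" A p "X p" "g p" 0 for p]
  by (simp add: vector_fields_def scale_field_def)

lemma add_in_vector_fields:
  assumes "smooth_manifold A" "X \<in> vector_fields A" "Y \<in> vector_fields A"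
  shows "X + Y \<in> vector_fields A"
  using assms smooth_add[OF assms(1)] tangent_space_lincomb[of "X p" A p "Y p" 1 1 for p]
  by (simp add: vector_fields_def plus_fun_def)

lemma diff_in_vector_fields:
  assumes "smooth_manifold A" "X \<in> vector_fields A" "Y \<in> vector_fields A"
  shows "X - Y \<in> vector_fields A"
  using assms smooth_diff[OF assms(1)] tangent_space_lincomb[of "X p" A p "Y p" 1 "- 1" for p]
  by (simp add: vector_fields_def fun_diff_def)

lemma zero_in_vector_fields: "0 \<in> vector_fields A"
  by (simp add: vector_fields_def zero_fun_def tangent_space_def smooth_const)

lemma sum_in_vector_fields:
  "smooth_manifold A \<Longrightarrow> (\<And>i. i \<in> I \<Longrightarrow> X i \<in> vector_fields A) \<Longrightarrow> sum X I \<in> vector_fields A"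
  by (induction I rule: infinite_finite_induct)
    (auto intro: zero_in_vector_fields add_in_vector_fields)

lemma sum_field_apply: "(\<Sum>i\<in>I. X i :: 'a vfield) p f = (\<Sum>i\<in>I. X i p f)"
  by (induction I rule: infinite_finite_induct) (auto simp: zero_fun_def)

text \<open>The frame fields with the numbers \<open>v (\<xi> i)\<close> as constant coefficients combine to an extension.\<close>

lemma tangent_vector_extends:
  fixes A :: "('a::{t2_space,second_countable_topology}, 'b::euclidean_space) atlas"
  assumes M: "smooth_manifold A" and v: "v \<in> tangent_space A p"
  shows "\<exists>X\<in>vector_fields A. X p = v"
proof -
  obtain \<rho> and I :: "('b \<times> bool) set" and \<xi> E where F: "\<rho> \<in> smooth_functions A" "\<rho> p = 1" "finite I"
    "\<And>i. i \<in> I \<Longrightarrow> \<xi> i \<in> smooth_functions A" "\<And>i. i \<in> I \<Longrightarrow> E i \<in> vector_fields A"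
    "\<And>q v f. v \<in> tangent_space A q \<Longrightarrow> \<rho> q * v f = (\<Sum>i\<in>I. v (\<xi> i) * E i q f)"
    by (rule local_frame[OF M, of p]) (rule that)
  let ?X = "\<Sum>i\<in>I. scale_field (\<lambda>q. v (\<xi> i)) (E i)"
  have "?X \<in> vector_fields A"
    by (intro sum_in_vector_fields scale_field_in_vector_fields M smooth_const F(5))
  moreover have "?X p f = v f" for f
    using F(6)[OF v, of f] F(2) by (simp add: sum_field_apply scale_field_def)
  ultimately show ?thesis by blast
qed

definition extension :: "('a, 'e::euclidean_space) atlas \<Rightarrow> 'a \<Rightarrow> 'a tangent \<Rightarrow> 'a vfield" where
  "extension A p v = (SOME X. X \<in> vector_fields A \<and> X p = v)"

lemma extension:
  assumes "smooth_manifold A" "v \<in> tangent_space A p"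
  shows "extension A p v \<in> vector_fields A" "extension A p v p = v"
  using someI_ex[of "\<lambda>X. X \<in> vector_fields A \<and> X p = v"] tangent_vector_extends[OF assms]
  by (auto simp: extension_def)

text \<open>Since the map is symmetric, additivity and homogeneity need only be demanded in the first slot.
  That keeps the verification for concrete formulas short.\<close>

definition sym_multilinear ::
  "('a, 'e::euclidean_space) atlas \<Rightarrow> nat \<Rightarrow> ('a vfield list \<Rightarrow> 'a \<Rightarrow> real) \<Rightarrow> bool" where
  "sym_multilinear A r T \<longleftrightarrow>
     (\<forall>Xs. length Xs = r \<and> set Xs \<subseteq> vector_fields A \<longrightarrow> T Xs \<in> smooth_functions A) \<and>
     (\<forall>Xs Ys. length Xs = r \<and> set Xs \<subseteq> vector_fields A \<and> mset Ys = mset Xs \<longrightarrow> T Ys = T Xs) \<and>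
     (\<forall>X Y Xs. Suc (length Xs) = r \<and> insert X (insert Y (set Xs)) \<subseteq> vector_fields A \<longrightarrow>
        T ((X + Y) # Xs) = (\<lambda>p. T (X # Xs) p + T (Y # Xs) p)) \<and>
     (\<forall>f X Xs. f \<in> smooth_functions A \<and> Suc (length Xs) = r \<and> insert X (set Xs) \<subseteq> vector_fields A \<longrightarrow>
        T (scale_field f X # Xs) = (\<lambda>p. f p * T (X # Xs) p))"

lemma sym_multilinear_smooth:
  "sym_multilinear A r T \<Longrightarrow> length Xs = r \<Longrightarrow> set Xs \<subseteq> vector_fields A \<Longrightarrow> T Xs \<in> smooth_functions A"
  unfolding sym_multilinear_def by blast

lemma sym_multilinear_perm:
  "sym_multilinear A r T \<Longrightarrow> length Xs = r \<Longrightarrow> set Xs \<subseteq> vector_fields A \<Longrightarrow> mset Ys = mset Xs \<Longrightarrow>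
    T Ys = T Xs"
  unfolding sym_multilinear_def by blast

lemma sym_multilinear_add:
  "sym_multilinear A r T \<Longrightarrow> Suc (length Xs) = r \<Longrightarrow> X \<in> vector_fields A \<Longrightarrow> Y \<in> vector_fields A \<Longrightarrow>
    set Xs \<subseteq> vector_fields A \<Longrightarrow> T ((X + Y) # Xs) p = T (X # Xs) p + T (Y # Xs) p"
  unfolding sym_multilinear_def
  by (elim conjE, drule spec[of _ X], drule spec[of _ Y], drule spec[of _ Xs]) simp

lemma sym_multilinear_scale:
  "sym_multilinear A r T \<Longrightarrow> Suc (length Xs) = r \<Longrightarrow> f \<in> smooth_functions A \<Longrightarrow> X \<in> vector_fields A \<Longrightarrow>
    set Xs \<subseteq> vector_fields A \<Longrightarrow> T (scale_field f X # Xs) p = f p * T (X # Xs) p"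
  unfolding sym_multilinear_def
  by (elim conjE, drule spec[of _ f], drule spec[of _ X], drule spec[of _ Xs]) simp

lemma sym_multilinear_sum:
  assumes M: "smooth_manifold A" and T: "sym_multilinear A r T" "Suc (length Xs) = r" "set Xs \<subseteq> vector_fields A"
    and "\<And>i. i \<in> I \<Longrightarrow> f i \<in> smooth_functions A" "\<And>i. i \<in> I \<Longrightarrow> E i \<in> vector_fields A" "finite I"
  shows "T ((\<Sum>i\<in>I. scale_field (f i) (E i)) # Xs) p = (\<Sum>i\<in>I. f i p * T (E i # Xs) p)"
  using assms(7,5,6)
proof (induction I rule: finite_induct)
  case empty
  have "scale_field (\<lambda>q. 0) 0 = (0 :: 'a vfield)" by (simp add: scale_field_def zero_fun_def)
  then have "T (0 # Xs) p = 0"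
    using sym_multilinear_scale[OF T(1,2) smooth_const[of 0] zero_in_vector_fields T(3)] by simp
  then show ?case by (simp only: sum.empty)
next
  case (insert i I)
  have "T ((scale_field (f i) (E i) + (\<Sum>i\<in>I. scale_field (f i) (E i))) # Xs) p =
      T (scale_field (f i) (E i) # Xs) p + T ((\<Sum>i\<in>I. scale_field (f i) (E i)) # Xs) p"
    using insert.prems
    by (intro sym_multilinear_add[OF T(1,2)] T(3) sum_in_vector_fields[OF M]
        scale_field_in_vector_fields[OF M]) auto
  moreover have "T (scale_field (f i) (E i) # Xs) p = f i p * T (E i # Xs) p"
    using insert.prems by (intro sym_multilinear_scale[OF T(1,2)] T(3)) auto
  ultimately show ?case
    using insert by (simp only: sum.insert insert_iff simp_thms)
qed

text \<open>Multiplication of the head by the cutoff \<open>\<rho>\<close> does not change the value at \<open>p\<close>, and the resulting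
  field is a combination of the global frame with coefficients \<open>Z (\<xi> i)\<close>. Their values at \<open>p\<close> depend only
  on \<open>Z p\<close>.\<close>

lemma sym_multilinear_pointwise_head:
  fixes A :: "('a::{t2_space,second_countable_topology}, 'b::euclidean_space) atlas"
  assumes M: "smooth_manifold A" and T: "sym_multilinear A r T" "Suc (length Xs) = r" "set Xs \<subseteq> vector_fields A"
    and XY: "X \<in> vector_fields A" "Y \<in> vector_fields A" "X p = Y p"
  shows "T (X # Xs) p = T (Y # Xs) p"
proof -
  obtain \<rho> and I :: "('b \<times> bool) set" and \<xi> E where F: "\<rho> \<in> smooth_functions A" "\<rho> p = 1" "finite I"
    "\<And>i. i \<in> I \<Longrightarrow> \<xi> i \<in> smooth_functions A" "\<And>i. i \<in> I \<Longrightarrow> E i \<in> vector_fields A"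
    "\<And>q v f. v \<in> tangent_space A q \<Longrightarrow> \<rho> q * v f = (\<Sum>i\<in>I. v (\<xi> i) * E i q f)"
    by (rule local_frame[OF M, of p]) (rule that)
  have "T (Z # Xs) p = (\<Sum>i\<in>I. Z p (\<xi> i) * T (E i # Xs) p)" if Z: "Z \<in> vector_fields A" for Z
  proof -
    have "T (Z # Xs) p = T (scale_field \<rho> Z # Xs) p"
      using sym_multilinear_scale[OF T(1,2) F(1) Z T(3)] F(2) by simp
    also have "scale_field \<rho> Z = (\<Sum>i\<in>I. scale_field (\<lambda>q. Z q (\<xi> i)) (E i))"
      by (intro ext) (simp add: scale_field_def sum_field_apply F(6)[OF vector_field_tangent[OF Z]])
    also have "T (\<dots> # Xs) p = (\<Sum>i\<in>I. Z p (\<xi> i) * T (E i # Xs) p)"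
      by (rule sym_multilinear_sum[OF M T]) (use F Z in \<open>auto intro: vector_field_smooth\<close>)
    finally show ?thesis .
  qed
  then show ?thesis using XY by simp
qed

lemma sym_multilinear_pointwise:
  assumes M: "smooth_manifold A" and T: "sym_multilinear A r T"
    and "length Xs = r" "set Xs \<subseteq> vector_fields A" "set Ys \<subseteq> vector_fields A"
    and "map (\<lambda>X. X p) Xs = map (\<lambda>X. X p) Ys"
  shows "T Xs p = T Ys p"
proof -
  have "T (Zs @ Xs) p = T (Zs @ Ys) p"
    if "length (Zs @ Xs) = r" "set (Zs @ Xs) \<subseteq> vector_fields A" "set Ys \<subseteq> vector_fields A"
      "map (\<lambda>X. X p) Xs = map (\<lambda>X. X p) Ys" for Zs
    using that
  proof (induction Xs arbitrary: Ys Zs)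
    case (Cons X Xs)
    then obtain Y Ys' where Y: "Ys = Y # Ys'" "X p = Y p" "map (\<lambda>X. X p) Xs = map (\<lambda>X. X p) Ys'"
      by (cases Ys) auto
    have "T (Zs @ X # Xs) p = T (X # Zs @ Xs) p"
      using Cons.prems by (subst sym_multilinear_perm[OF T, of "X # Zs @ Xs"]) auto
    also have "\<dots> = T (Y # Zs @ Xs) p"
      using Cons.prems Y by (intro sym_multilinear_pointwise_head[OF M T]) auto
    also have "\<dots> = T ((Zs @ [Y]) @ Xs) p"
      using Cons.prems Y by (subst sym_multilinear_perm[OF T, of "(Zs @ [Y]) @ Xs"]) auto
    also have "\<dots> = T ((Zs @ [Y]) @ Ys') p"
      using Cons.prems Y by (intro Cons.IH) auto
    finally show ?case using Y by simp
  qed simp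
  from this[of "[]"] show ?thesis using assms by simp
qed

lemma mset_list_update_remove:
  "i < length xs \<Longrightarrow> mset (xs[i := x]) = mset (x # take i xs @ drop (Suc i) xs)"
  by (simp add: upd_conv_take_nth_drop)

lemma set_take_drop_subset: "set (take i xs @ drop j xs) \<subseteq> set xs"
  by (auto dest: in_set_takeD in_set_dropD)

lemma sym_forms_I:
  assumes lin: "\<And>vs u w a b. Suc (length vs) = r \<Longrightarrow> set vs \<subseteq> tangent_space A p \<Longrightarrow>
      u \<in> tangent_space A p \<Longrightarrow> w \<in> tangent_space A p \<Longrightarrow>
      \<omega> ((\<lambda>f. a * u f + b * w f) # vs) = a * \<omega> (u # vs) + b * \<omega> (w # vs)"
    and perm: "\<And>vs ws. length vs = r \<Longrightarrow> set vs \<subseteq> tangent_space A p \<Longrightarrow> mset ws = mset vs \<Longrightarrow> \<omega> ws = \<omega> vs"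
    and zero: "\<And>vs. \<not> (length vs = r \<and> set vs \<subseteq> tangent_space A p) \<Longrightarrow> \<omega> vs = 0"
  shows "\<omega> \<in> sym_forms A r p"
  unfolding sym_forms_def
proof (intro CollectI conjI allI impI)
  fix vs i u w a b
  assume asm: "length vs = r \<and> set vs \<subseteq> tangent_space A p \<and> i < r \<and>
        u \<in> tangent_space A p \<and> w \<in> tangent_space A p"
  let ?R = "take i vs @ drop (Suc i) vs"
  have R: "Suc (length ?R) = r" "set ?R \<subseteq> tangent_space A p"
    using asm set_take_drop_subset[of i vs "Suc i"] by (auto simp del: set_append)
  have upd: "\<omega> (vs[i := x]) = \<omega> (x # ?R)" if "x \<in> tangent_space A p" for x
    by (rule perm) (use that asm R in \<open>auto simp: mset_list_update_remove\<close>)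
  show "\<omega> (vs[i := (\<lambda>f. a * u f + b * w f)]) = a * \<omega> (vs[i := u]) + b * \<omega> (vs[i := w])"
    using asm lin[OF R] tangent_space_lincomb[of u A p w a b] by (simp add: upd)
qed (use perm zero in auto)

lemma sym_form_head:
  assumes "\<omega> \<in> sym_forms A r p" "Suc (length vs) = r" "set vs \<subseteq> tangent_space A p"
    "u \<in> tangent_space A p" "w \<in> tangent_space A p"
  shows "\<omega> ((\<lambda>f. a * u f + b * w f) # vs) = a * \<omega> (u # vs) + b * \<omega> (w # vs)"
proof -
  have "\<forall>vs i u w a b. length vs = r \<and> set vs \<subseteq> tangent_space A p \<and> i < r \<and>
       u \<in> tangent_space A p \<and> w \<in> tangent_space A p \<longrightarrow>
       \<omega> (vs[i := (\<lambda>f. a * u f + b * w f)]) = a * \<omega> (vs[i := u]) + b * \<omega> (vs[i := w])"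
    using assms(1) unfolding sym_forms_def by blast
  from this[rule_format, of "u # vs" 0 u w a b] show ?thesis using assms by simp
qed

lemma sym_form_perm:
  "\<omega> \<in> sym_forms A r p \<Longrightarrow> length vs = r \<Longrightarrow> set vs \<subseteq> tangent_space A p \<Longrightarrow> mset ws = mset vs \<Longrightarrow>
    \<omega> ws = \<omega> vs"
  unfolding sym_forms_def by blast

lemma sym_form_zero:
  "\<omega> \<in> sym_forms A r p \<Longrightarrow> \<not> (length vs = r \<and> set vs \<subseteq> tangent_space A p) \<Longrightarrow> \<omega> vs = 0"
  unfolding sym_forms_def by blast

lemma sym_tensor_form: "\<phi> \<in> sym_tensors A r \<Longrightarrow> \<phi> p \<in> sym_forms A r p"
  by (simp add: sym_tensors_def)

lemma map_vector_fields_tangent: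
  "set Xs \<subseteq> vector_fields A \<Longrightarrow> set (map (\<lambda>X. X p) Xs) \<subseteq> tangent_space A p"
  by (auto intro: vector_field_tangent)

lemma eval_tensor_sym_multilinear:
  assumes "\<phi> \<in> sym_tensors A r"
  shows "sym_multilinear A r (eval_tensor \<phi>)"
  unfolding sym_multilinear_def
proof (intro conjI allI impI)
  note F = sym_tensor_form[OF assms]
  show "eval_tensor \<phi> Xs \<in> smooth_functions A" if "length Xs = r \<and> set Xs \<subseteq> vector_fields A" for Xs
    using assms that by (simp add: sym_tensors_def)
  show "eval_tensor \<phi> Ys = eval_tensor \<phi> Xs"
    if "length Xs = r \<and> set Xs \<subseteq> vector_fields A \<and> mset Ys = mset Xs" for Xs Ys
    unfolding eval_tensor_def
    by (intro ext sym_form_perm[OF F]) (use that in \<open>auto intro: vector_field_tangent\<close>)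
  show "eval_tensor \<phi> ((X + Y) # Xs) = (\<lambda>p. eval_tensor \<phi> (X # Xs) p + eval_tensor \<phi> (Y # Xs) p)"
    if "Suc (length Xs) = r \<and> insert X (insert Y (set Xs)) \<subseteq> vector_fields A" for X Y Xs
  proof
    fix p
    have "(X + Y) p = (\<lambda>f. 1 * X p f + 1 * Y p f)" by (simp add: plus_fun_def)
    then show "eval_tensor \<phi> ((X + Y) # Xs) p = eval_tensor \<phi> (X # Xs) p + eval_tensor \<phi> (Y # Xs) p"
      using sym_form_head[OF F, of "map (\<lambda>X. X p) Xs" p "X p" "Y p" 1 1] that
        map_vector_fields_tangent[of Xs A p]
      by (simp add: eval_tensor_def vector_field_tangent)
  qed
  show "eval_tensor \<phi> (scale_field f X # Xs) = (\<lambda>p. f p * eval_tensor \<phi> (X # Xs) p)"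
    if "f \<in> smooth_functions A \<and> Suc (length Xs) = r \<and> insert X (set Xs) \<subseteq> vector_fields A" for f X Xs
  proof
    fix p
    have "scale_field f X p = (\<lambda>g. f p * X p g + 0 * X p g)" by (simp add: scale_field_def)
    then show "eval_tensor \<phi> (scale_field f X # Xs) p = f p * eval_tensor \<phi> (X # Xs) p"
      using sym_form_head[OF F, of "map (\<lambda>X. X p) Xs" p "X p" "X p" "f p" 0] that
        map_vector_fields_tangent[of Xs A p]
      by (simp add: eval_tensor_def vector_field_tangent)
  qed
qed

text \<open>Tensor fields are determined by global vector fields because every tangent vector extends to one.\<close>

lemma sym_tensor_eqI:
  assumes M: "smooth_manifold A" and "\<phi> \<in> sym_tensors A r" "\<psi> \<in> sym_tensors A r"
    and eq: "\<And>Xs p. length Xs = r \<Longrightarrow> set Xs \<subseteq> vector_fields A \<Longrightarrow> eval_tensor \<phi> Xs p = eval_tensor \<psi> Xs p"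
  shows "\<phi> = \<psi>"
proof (intro ext)
  fix p vs
  show "\<phi> p vs = \<psi> p vs"
  proof (cases "length vs = r \<and> set vs \<subseteq> tangent_space A p")
    case True
    let ?Xs = "map (extension A p) vs"
    have "set ?Xs \<subseteq> vector_fields A" using True extension[OF M] by auto
    moreover have "map (\<lambda>X. X p) ?Xs = vs" using True extension[OF M] by (auto intro!: map_idI)
    ultimately show ?thesis using eq[of ?Xs p] True unfolding eval_tensor_def by simp
  next
    case False
    then show ?thesis using assms(2,3) sym_form_zero[OF sym_tensor_form] by metis
  qed
qed

text \<open>The tensor is obtained by extending tangent vectors to vector fields; by pointwise dependence the
  choice of the extensions does not matter. The statement has the form in which
  \<^const>\<open>cov_deriv\<close> and \<^const>\<open>sym_deriv\<close> are defined.\<close>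

lemma sym_multilinear_imp_tensor:
  assumes M: "smooth_manifold A" and T: "sym_multilinear A r T"
  shows "\<exists>!\<psi>. \<psi> \<in> sym_tensors A r \<and>
    (\<forall>Xs. length Xs = r \<and> set Xs \<subseteq> vector_fields A \<longrightarrow> (\<forall>p. eval_tensor \<psi> Xs p = T Xs p))"
proof (rule ex1I)
  define \<psi> where "\<psi> p vs = (
      if length vs = r \<and> set vs \<subseteq> tangent_space A p then T (map (extension A p) vs) p else 0)"
    for p vs
  have ext: "set (map (extension A p) vs) \<subseteq> vector_fields A" if "set vs \<subseteq> tangent_space A p" for p vs
    using that extension(1)[OF M] by auto
  have extp: "map (\<lambda>X. X p) (map (extension A p) vs) = vs" if "set vs \<subseteq> tangent_space A p" for p vs
    using that extension(2)[OF M] by (auto intro!: map_idI)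
  have eval: "eval_tensor \<psi> Xs p = T Xs p" if Xs: "length Xs = r" "set Xs \<subseteq> vector_fields A" for Xs p
  proof -
    note t = map_vector_fields_tangent[OF Xs(2), of p]
    have "T (map (extension A p) (map (\<lambda>X. X p) Xs)) p = T Xs p"
      by (rule sym_multilinear_pointwise[OF M T]) (use Xs ext[OF t] extp[OF t] in simp_all)
    then show ?thesis using Xs t by (simp add: eval_tensor_def \<psi>_def)
  qed
  have form: "\<psi> p \<in> sym_forms A r p" for p
  proof (rule sym_forms_I)
    fix vs u w and a b :: real
    assume vs: "Suc (length vs) = r" "set vs \<subseteq> tangent_space A p"
      and u: "u \<in> tangent_space A p" and w: "w \<in> tangent_space A p"
    let ?e = "extension A p" and ?z = "\<lambda>f. a * u f + b * w f"
    let ?Z = "scale_field (\<lambda>q. a) (?e u) + scale_field (\<lambda>q. b) (?e w)"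
    have z: "?z \<in> tangent_space A p" using tangent_space_lincomb[OF u w] .
    note e = extension[OF M]
    have S: "scale_field (\<lambda>q. a) (?e u) \<in> vector_fields A" "scale_field (\<lambda>q. b) (?e w) \<in> vector_fields A"
      using e u w by (auto intro!: scale_field_in_vector_fields M smooth_const)
    have "\<psi> p (?z # vs) = T (?e ?z # map ?e vs) p"
      using vs z by (simp add: \<psi>_def)
    also have "\<dots> = T (?Z # map ?e vs) p"
      using vs ext[OF vs(2)] e[OF z] e(2)[OF u] e(2)[OF w] S
      by (intro sym_multilinear_pointwise_head[OF M T] add_in_vector_fields[OF M])
        (auto simp: scale_field_def)
    also have "\<dots> = a * T (?e u # map ?e vs) p + b * T (?e w # map ?e vs) p"
      using vs ext[OF vs(2)] e(1)[OF u] e(1)[OF w] S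
      by (simp add: sym_multilinear_add[OF T] sym_multilinear_scale[OF T] smooth_const)
    finally show "\<psi> p (?z # vs) = a * \<psi> p (u # vs) + b * \<psi> p (w # vs)"
      using vs u w by (simp add: \<psi>_def)
  next
    fix vs ws assume vs: "length vs = r" "set vs \<subseteq> tangent_space A p" "mset ws = mset vs"
    have "T (map (extension A p) ws) = T (map (extension A p) vs)"
      by (rule sym_multilinear_perm[OF T]) (use vs ext in auto)
    then show "\<psi> p ws = \<psi> p vs"
      using vs mset_eq_length[OF vs(3)] mset_eq_setD[OF vs(3)] by (simp add: \<psi>_def)
  qed (auto simp: \<psi>_def)
  have "\<psi> \<in> sym_tensors A r"
    unfolding sym_tensors_def
  proof (intro CollectI conjI allI impI form)
    fix Xs assume "length Xs = r \<and> set Xs \<subseteq> vector_fields A"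
    moreover then have "eval_tensor \<psi> Xs = T Xs" using eval by blast
    ultimately show "eval_tensor \<psi> Xs \<in> smooth_functions A"
      using sym_multilinear_smooth[OF T] by simp
  qed
  with eval show \<psi>: "\<psi> \<in> sym_tensors A r \<and>
    (\<forall>Xs. length Xs = r \<and> set Xs \<subseteq> vector_fields A \<longrightarrow> (\<forall>p. eval_tensor \<psi> Xs p = T Xs p))" by blast
  fix \<psi>' assume "\<psi>' \<in> sym_tensors A r \<and>
    (\<forall>Xs. length Xs = r \<and> set Xs \<subseteq> vector_fields A \<longrightarrow> (\<forall>p. eval_tensor \<psi>' Xs p = T Xs p))"
  with \<psi> show "\<psi>' = \<psi>" by (intro sym_tensor_eqI[OF M, of _ r]) auto
qed

section \<open>Covariant and symmetric derivatives\<close>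

lemma set_list_update_subset_insert: "set Xs \<subseteq> V \<Longrightarrow> X \<in> V \<Longrightarrow> set (Xs[i := X]) \<subseteq> V"
  using set_update_subset_insert[of Xs i X] by blast

lemma sym_multilinear_slot:
  assumes "sym_multilinear A r T" "length Xs = r" "set Xs \<subseteq> vector_fields A" "i < r" "X \<in> vector_fields A"
  shows "T (Xs[i := X]) = T (X # take i Xs @ drop (Suc i) Xs)"
  using assms set_take_drop_subset[of i Xs "Suc i"]
  by (intro sym_multilinear_perm[OF assms(1)]) (auto simp: mset_list_update_remove)

lemma sym_multilinear_slot_add:
  assumes T: "sym_multilinear A r T" "length Xs = r" "set Xs \<subseteq> vector_fields A" "i < r"
    and XY: "X \<in> vector_fields A" "Y \<in> vector_fields A" "X + Y \<in> vector_fields A"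
  shows "T (Xs[i := X + Y]) p = T (Xs[i := X]) p + T (Xs[i := Y]) p"
  unfolding sym_multilinear_slot[OF T XY(1)] sym_multilinear_slot[OF T XY(2)] sym_multilinear_slot[OF T XY(3)]
  using assms set_take_drop_subset[of i Xs "Suc i"] by (intro sym_multilinear_add[OF T(1)]) auto

lemma sym_multilinear_slot_scale:
  assumes T: "sym_multilinear A r T" "length Xs = r" "set Xs \<subseteq> vector_fields A" "i < r"
    and X: "X \<in> vector_fields A" "scale_field f X \<in> vector_fields A" "f \<in> smooth_functions A"
  shows "T (Xs[i := scale_field f X]) p = f p * T (Xs[i := X]) p"
  unfolding sym_multilinear_slot[OF T X(1)] sym_multilinear_slot[OF T X(2)]
  using assms set_take_drop_subset[of i Xs "Suc i"] by (intro sym_multilinear_scale[OF T(1)]) auto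

lemma sum_nth_perm:
  fixes H :: "'x \<Rightarrow> 'y::comm_monoid_add"
  assumes "mset Ys = mset Xs" "length Xs = n"
  shows "(\<Sum>i<n. H (Ys ! i)) = (\<Sum>i<n. H (Xs ! i))"
proof -
  have "(\<Sum>i<n. H (Zs ! i)) = sum_mset (image_mset H (mset Zs))" if "length Zs = n" for Zs
    using that sum_mset_sum_list[of "map H Zs"] by (simp add: sum_list_sum_nth atLeast0LessThan)
  then show ?thesis using assms mset_eq_length[OF assms(1)] by simp
qed

lemma mset_remove_nth:
  "i < length Xs \<Longrightarrow> mset (take i Xs @ drop (Suc i) Xs) = mset Xs - {#Xs ! i#}"
  using arg_cong[OF id_take_nth_drop[of i Xs], of mset] by simp

text \<open>Moving the changed slot to the front expresses each term by the entry \<open>Z\<close> and the multiset of the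
  remaining entries, so the sum depends only on the multiset of entries.\<close>

lemma sum_slots_perm:
  assumes T: "sym_multilinear A r T" and Xs: "length Xs = r" "set Xs \<subseteq> vector_fields A" "mset Ys = mset Xs"
    and B: "\<And>Z. Z \<in> vector_fields A \<Longrightarrow> B Z \<in> vector_fields A"
  shows "(\<Sum>i<r. T (Ys[i := B (Ys ! i)]) p) = (\<Sum>i<r. T (Xs[i := B (Xs ! i)]) p)"
proof -
  \<comment> \<open>A term of the sum as a function of the entry alone, with the multiset of all entries fixed.\<close>
  define H where "H Z = T (B Z # remove1 Z Xs) p" for Z
  have "T (Zs[i := B (Zs ! i)]) p = H (Zs ! i)" if Zs: "mset Zs = mset Xs" and i: "i < r" for Zs i
  proof -
    have Z: "length Zs = r" "set Zs \<subseteq> vector_fields A" "Zs ! i \<in> set Zs"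
      using Xs Zs i mset_eq_length[OF Zs] mset_eq_setD[OF Zs] by auto
    then have "B (Zs ! i) \<in> vector_fields A" using B by blast
    then have "T (B (Zs ! i) # remove1 (Zs ! i) Xs) = T (Zs[i := B (Zs ! i)])"
      using Z i Zs by (intro sym_multilinear_perm[OF T] set_list_update_subset_insert)
        (auto simp: mset_update)
    then show ?thesis by (simp add: H_def)
  qed
  then show ?thesis using sum_nth_perm[OF Xs(3,1), of H] Xs(3) by simp
qed

locale affine_manifold =
  fixes A :: "('a::{t2_space,second_countable_topology}, 'e::euclidean_space) atlas"
    and D :: "'a vfield \<Rightarrow> 'a vfield \<Rightarrow> 'a vfield"
  assumes M: "smooth_manifold A" and connection: "affine_connection A D"
begin

abbreviation "\<X> \<equiv> vector_fields A"

lemma connection_closed: "X \<in> \<X> \<Longrightarrow> Y \<in> \<X> \<Longrightarrow> D X Y \<in> \<X>"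
  and connection_add_left: "X \<in> \<X> \<Longrightarrow> X' \<in> \<X> \<Longrightarrow> Y \<in> \<X> \<Longrightarrow> D (X + X') Y = D X Y + D X' Y"
  and connection_add_right: "X \<in> \<X> \<Longrightarrow> Y \<in> \<X> \<Longrightarrow> Y' \<in> \<X> \<Longrightarrow> D X (Y + Y') = D X Y + D X Y'"
  and connection_scale_left: "f \<in> smooth_functions A \<Longrightarrow> X \<in> \<X> \<Longrightarrow> Y \<in> \<X> \<Longrightarrow>
    D (scale_field f X) Y = scale_field f (D X Y)"
  and connection_Leibniz: "f \<in> smooth_functions A \<Longrightarrow> X \<in> \<X> \<Longrightarrow> Y \<in> \<X> \<Longrightarrow>
    D X (scale_field f Y) = scale_field f (D X Y) + scale_field (\<lambda>p. X p f) Y"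
  using connection unfolding affine_connection_def by blast+

definition cov_form :: "nat \<Rightarrow> 'a vfield \<Rightarrow> 'a tensor_field \<Rightarrow> 'a vfield list \<Rightarrow> 'a \<Rightarrow> real" where
  "cov_form r X \<phi> Ys p =
     X p (eval_tensor \<phi> Ys) - (\<Sum>i<r. eval_tensor \<phi> (Ys[i := D X (Ys ! i)]) p)"

lemma cov_form_Cons:
  "cov_form (Suc r) X \<phi> (U # Ws) p = X p (eval_tensor \<phi> (U # Ws)) - eval_tensor \<phi> (D X U # Ws) p
     - (\<Sum>i<r. eval_tensor \<phi> (U # Ws[i := D X (Ws ! i)]) p)"
  unfolding cov_form_def by (subst sum.lessThan_Suc_shift) simp

text \<open>Homogeneity is the only nontrivial condition: the term \<open>(X f) \<phi>(U, \<dots>)\<close> from differentiating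
  \<open>\<phi>(f U, \<dots>) = f \<phi>(U, \<dots>)\<close> cancels against the one from the Leibniz rule for \<open>D X (f U)\<close>.\<close>

lemma cov_form_sym_multilinear:
  assumes \<phi>: "\<phi> \<in> sym_tensors A r" and X: "X \<in> \<X>"
  shows "sym_multilinear A r (cov_form r X \<phi>)"
  unfolding sym_multilinear_def
proof (intro conjI allI impI)
  note T = eval_tensor_sym_multilinear[OF \<phi>]
  fix Xs assume "length Xs = r \<and> set Xs \<subseteq> \<X>"
  then have Xs: "length Xs = r" "set Xs \<subseteq> \<X>" by auto
  have "(\<lambda>p. \<Sum>i<r. eval_tensor \<phi> (Xs[i := D X (Xs ! i)]) p) \<in> smooth_functions A"
    using Xs X
    by (intro smooth_sum[OF M] sym_multilinear_smooth[OF T] set_list_update_subset_insert connection_closed) auto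
  then show "cov_form r X \<phi> Xs \<in> smooth_functions A"
    unfolding cov_form_def[abs_def]
    by (intro smooth_diff[OF M] vector_field_smooth[OF X] sym_multilinear_smooth[OF T] Xs)
next
  note T = eval_tensor_sym_multilinear[OF \<phi>]
  fix Xs Ys assume Xs: "length Xs = r \<and> set Xs \<subseteq> \<X> \<and> mset Ys = mset Xs"
  then show "cov_form r X \<phi> Ys = cov_form r X \<phi> Xs"
    unfolding cov_form_def[abs_def]
    using sym_multilinear_perm[OF T, of Xs Ys] sum_slots_perm[OF T, of Xs Ys "D X"] connection_closed[OF X]
    by simp
next
  note T = eval_tensor_sym_multilinear[OF \<phi>]
  fix U V Ws assume "Suc (length Ws) = r \<and> insert U (insert V (set Ws)) \<subseteq> \<X>"
  then have H: "Suc (length Ws) = r" "U \<in> \<X>" "V \<in> \<X>" "set Ws \<subseteq> \<X>" by auto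
  show "cov_form r X \<phi> ((U + V) # Ws) = (\<lambda>p. cov_form r X \<phi> (U # Ws) p + cov_form r X \<phi> (V # Ws) p)"
  proof
    fix p
    have "eval_tensor \<phi> ((U + V) # Ws) = (\<lambda>p. eval_tensor \<phi> (U # Ws) p + eval_tensor \<phi> (V # Ws) p)"
      using H by (intro ext sym_multilinear_add[OF T]) auto
    then have 1: "X p (eval_tensor \<phi> ((U + V) # Ws)) =
        X p (eval_tensor \<phi> (U # Ws)) + X p (eval_tensor \<phi> (V # Ws))"
      using H by (simp add: tangent_add[OF vector_field_tangent[OF X]] sym_multilinear_smooth[OF T])
    have 2: "eval_tensor \<phi> (D X (U + V) # Ws) p =
        eval_tensor \<phi> (D X U # Ws) p + eval_tensor \<phi> (D X V # Ws) p"
      unfolding connection_add_right[OF X H(2,3)]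
      using H X by (intro sym_multilinear_add[OF T] connection_closed) auto
    have 3: "eval_tensor \<phi> ((U + V) # Ws[i := D X (Ws ! i)]) p =
        eval_tensor \<phi> (U # Ws[i := D X (Ws ! i)]) p + eval_tensor \<phi> (V # Ws[i := D X (Ws ! i)]) p"
      if "i < length Ws" for i
      using H X that
      by (intro sym_multilinear_add[OF T] set_list_update_subset_insert connection_closed) auto
    show "cov_form r X \<phi> ((U + V) # Ws) p = cov_form r X \<phi> (U # Ws) p + cov_form r X \<phi> (V # Ws) p"
      unfolding H(1)[symmetric] cov_form_Cons 1 2 by (simp add: 3 sum.distrib)
  qed
next
  note T = eval_tensor_sym_multilinear[OF \<phi>]
  fix f U Ws assume "f \<in> smooth_functions A \<and> Suc (length Ws) = r \<and> insert U (set Ws) \<subseteq> \<X>"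
  then have H: "Suc (length Ws) = r" "f \<in> smooth_functions A" "U \<in> \<X>" "set Ws \<subseteq> \<X>" by auto
  show "cov_form r X \<phi> (scale_field f U # Ws) = (\<lambda>p. f p * cov_form r X \<phi> (U # Ws) p)"
  proof
    fix p
    have "eval_tensor \<phi> (scale_field f U # Ws) = (\<lambda>p. f p * eval_tensor \<phi> (U # Ws) p)"
      using H by (intro ext sym_multilinear_scale[OF T]) auto
    then have 1: "X p (eval_tensor \<phi> (scale_field f U # Ws)) =
        f p * X p (eval_tensor \<phi> (U # Ws)) + X p f * eval_tensor \<phi> (U # Ws) p"
      using H by (simp add: tangent_mult[OF vector_field_tangent[OF X]] sym_multilinear_smooth[OF T])
    have "(\<lambda>p. X p f) \<in> smooth_functions A" by (rule vector_field_smooth[OF X H(2)])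
    note sc = sym_multilinear_scale[OF T H(1) H(2) _ H(4)] sym_multilinear_scale[OF T H(1) this _ H(4)]
      scale_field_in_vector_fields[OF M H(2)] scale_field_in_vector_fields[OF M this]
    have "eval_tensor \<phi> (D X (scale_field f U) # Ws) p =
        eval_tensor \<phi> (scale_field f (D X U) # Ws) p + eval_tensor \<phi> (scale_field (\<lambda>p. X p f) U # Ws) p"
      unfolding connection_Leibniz[OF H(2) X H(3)]
      using H X by (intro sym_multilinear_add[OF T] connection_closed sc) auto
    then have 2: "eval_tensor \<phi> (D X (scale_field f U) # Ws) p =
        f p * eval_tensor \<phi> (D X U # Ws) p + X p f * eval_tensor \<phi> (U # Ws) p"
      using H X connection_closed[OF X H(3)] by (simp add: sc)
    have 3: "eval_tensor \<phi> (scale_field f U # Ws[i := D X (Ws ! i)]) p =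
        f p * eval_tensor \<phi> (U # Ws[i := D X (Ws ! i)]) p"
      if "i < length Ws" for i
      using H X that
      by (intro sym_multilinear_scale[OF T] set_list_update_subset_insert connection_closed) auto
    show "cov_form r X \<phi> (scale_field f U # Ws) p = f p * cov_form r X \<phi> (U # Ws) p"
      unfolding H(1)[symmetric] cov_form_Cons 1 2
      by (simp add: 3 sum_distrib_left[symmetric] algebra_simps)
  qed
qed

lemma cov_deriv:
  assumes "\<phi> \<in> sym_tensors A r" "X \<in> \<X>"
  shows cov_deriv_sym_tensor: "cov_deriv A D r X \<phi> \<in> sym_tensors A r"
    and eval_cov_deriv: "\<And>Ys p. length Ys = r \<Longrightarrow> set Ys \<subseteq> \<X> \<Longrightarrow>
      eval_tensor (cov_deriv A D r X \<phi>) Ys p = cov_form r X \<phi> Ys p"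
  using theI'[OF sym_multilinear_imp_tensor[OF M cov_form_sym_multilinear[OF assms]]]
  unfolding cov_deriv_def cov_form_def[abs_def] by blast+

definition sym_deriv_form :: "nat \<Rightarrow> 'a tensor_field \<Rightarrow> 'a vfield list \<Rightarrow> 'a \<Rightarrow> real" where
  "sym_deriv_form r \<phi> Xs p =
     (\<Sum>j<Suc r. eval_tensor (cov_deriv A D r (Xs ! j) \<phi>) (take j Xs @ drop (Suc j) Xs) p)"

lemma sym_deriv_form_Cons:
  "sym_deriv_form r \<phi> (U # Ws) p = eval_tensor (cov_deriv A D r U \<phi>) Ws p +
     (\<Sum>j<r. eval_tensor (cov_deriv A D r (Ws ! j) \<phi>) (U # take j Ws @ drop (Suc j) Ws) p)"
  unfolding sym_deriv_form_def by (subst sum.lessThan_Suc_shift) simp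

lemma eval_cov_deriv_add:
  assumes \<phi>: "\<phi> \<in> sym_tensors A r" and UV: "U \<in> \<X>" "V \<in> \<X>" and Ws: "length Ws = r" "set Ws \<subseteq> \<X>"
  shows "eval_tensor (cov_deriv A D r (U + V) \<phi>) Ws p =
    eval_tensor (cov_deriv A D r U \<phi>) Ws p + eval_tensor (cov_deriv A D r V \<phi>) Ws p"
proof -
  note T = eval_tensor_sym_multilinear[OF \<phi>]
  have "eval_tensor \<phi> (Ws[i := D (U + V) (Ws ! i)]) p =
      eval_tensor \<phi> (Ws[i := D U (Ws ! i)]) p + eval_tensor \<phi> (Ws[i := D V (Ws ! i)]) p" if "i < r" for i
  proof -
    have "Ws ! i \<in> \<X>" using Ws that by auto
    then show ?thesis
      unfolding connection_add_left[OF UV \<open>Ws ! i \<in> \<X>\<close>]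
      using Ws that UV by (intro sym_multilinear_slot_add[OF T] connection_closed add_in_vector_fields[OF M])
  qed
  then show ?thesis
    using Ws UV by (simp add: eval_cov_deriv[OF \<phi>] add_in_vector_fields[OF M] cov_form_def sum.distrib)
qed

lemma eval_cov_deriv_scale:
  assumes \<phi>: "\<phi> \<in> sym_tensors A r" and U: "f \<in> smooth_functions A" "U \<in> \<X>"
    and Ws: "length Ws = r" "set Ws \<subseteq> \<X>"
  shows "eval_tensor (cov_deriv A D r (scale_field f U) \<phi>) Ws p =
    f p * eval_tensor (cov_deriv A D r U \<phi>) Ws p"
proof -
  note T = eval_tensor_sym_multilinear[OF \<phi>]
  have "eval_tensor \<phi> (Ws[i := D (scale_field f U) (Ws ! i)]) p =
      f p * eval_tensor \<phi> (Ws[i := D U (Ws ! i)]) p" if "i < r" for i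
  proof -
    have "Ws ! i \<in> \<X>" using Ws that by auto
    then show ?thesis
      unfolding connection_scale_left[OF U \<open>Ws ! i \<in> \<X>\<close>]
      using Ws that U
      by (intro sym_multilinear_slot_scale[OF T] connection_closed scale_field_in_vector_fields[OF M])
  qed
  moreover have "scale_field f U p g = f p * U p g" for g by (simp add: scale_field_def)
  ultimately show ?thesis
    using Ws U by (simp add: eval_cov_deriv[OF \<phi>] scale_field_in_vector_fields[OF M] cov_form_def
        sum_distrib_left[symmetric] right_diff_distrib)
qed

lemma sym_deriv_form_sym_multilinear:
  assumes \<phi>: "\<phi> \<in> sym_tensors A r"
  shows "sym_multilinear A (Suc r) (sym_deriv_form r \<phi>)"
  unfolding sym_multilinear_def
proof (intro conjI allI impI)
  note C = eval_tensor_sym_multilinear[OF cov_deriv_sym_tensor[OF \<phi>]]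
  {
    fix Xs assume "length Xs = Suc r \<and> set Xs \<subseteq> \<X>"
    then have Xs: "length Xs = Suc r" "set Xs \<subseteq> \<X>" by auto
    then show "sym_deriv_form r \<phi> Xs \<in> smooth_functions A"
      unfolding sym_deriv_form_def[abs_def]
      using set_take_drop_subset[of _ Xs]
      by (intro smooth_sum[OF M] sym_multilinear_smooth[OF C]) (auto dest: in_set_takeD in_set_dropD)
  next
    fix Xs Ys assume "length Xs = Suc r \<and> set Xs \<subseteq> \<X> \<and> mset Ys = mset Xs"
    then have Xs: "length Xs = Suc r" "set Xs \<subseteq> \<X>" "mset Ys = mset Xs" by auto
    show "sym_deriv_form r \<phi> Ys = sym_deriv_form r \<phi> Xs"
    proof
      fix p
      \<comment> \<open>A term of the sum as a function of the entry alone, with the multiset of all entries fixed.\<close>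
      define H where "H Z = eval_tensor (cov_deriv A D r Z \<phi>) (remove1 Z Xs) p" for Z
      have "eval_tensor (cov_deriv A D r (Zs ! j) \<phi>) (take j Zs @ drop (Suc j) Zs) p = H (Zs ! j)"
        if Zs: "mset Zs = mset Xs" and j: "j < Suc r" for Zs j
      proof -
        have Z: "length Zs = Suc r" "set Zs \<subseteq> \<X>" "Zs ! j \<in> set Zs"
          using Xs Zs j mset_eq_length[OF Zs] mset_eq_setD[OF Zs] by auto
        have "eval_tensor (cov_deriv A D r (Zs ! j) \<phi>) (remove1 (Zs ! j) Xs) =
            eval_tensor (cov_deriv A D r (Zs ! j) \<phi>) (take j Zs @ drop (Suc j) Zs)"
        proof (rule sym_multilinear_perm[OF C])
          show "mset (remove1 (Zs ! j) Xs) = mset (take j Zs @ drop (Suc j) Zs)"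
            using Z j Zs by (subst mset_remove_nth) auto
          show "set (take j Zs @ drop (Suc j) Zs) \<subseteq> \<X>"
            using Z(2) set_take_drop_subset[of j Zs "Suc j"] by blast
        qed (use Z j in auto)
        then show ?thesis by (simp add: H_def)
      qed
      then show "sym_deriv_form r \<phi> Ys p = sym_deriv_form r \<phi> Xs p"
        unfolding sym_deriv_form_def using sum_nth_perm[OF Xs(3,1), of H] Xs(3) by simp
    qed
  next
    fix U V Ws assume "Suc (length Ws) = Suc r \<and> insert U (insert V (set Ws)) \<subseteq> \<X>"
    then have H: "length Ws = r" "U \<in> \<X>" "V \<in> \<X>" "set Ws \<subseteq> \<X>" by auto
    have "eval_tensor (cov_deriv A D r (Ws ! j) \<phi>) ((U + V) # take j Ws @ drop (Suc j) Ws) p =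
        eval_tensor (cov_deriv A D r (Ws ! j) \<phi>) (U # take j Ws @ drop (Suc j) Ws) p +
        eval_tensor (cov_deriv A D r (Ws ! j) \<phi>) (V # take j Ws @ drop (Suc j) Ws) p"
      if "j < r" for j p
    proof (rule sym_multilinear_add[OF C])
      show "set (take j Ws @ drop (Suc j) Ws) \<subseteq> \<X>"
        using H(4) set_take_drop_subset[of j Ws "Suc j"] by blast
    qed (use H that in auto)
    then show "sym_deriv_form r \<phi> ((U + V) # Ws) =
        (\<lambda>p. sym_deriv_form r \<phi> (U # Ws) p + sym_deriv_form r \<phi> (V # Ws) p)"
      using eval_cov_deriv_add[OF \<phi> H(2,3,1,4)]
      by (intro ext) (simp add: sym_deriv_form_Cons sum.distrib)
  next
    fix f U Ws assume "f \<in> smooth_functions A \<and> Suc (length Ws) = Suc r \<and> insert U (set Ws) \<subseteq> \<X>"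
    then have H: "length Ws = r" "f \<in> smooth_functions A" "U \<in> \<X>" "set Ws \<subseteq> \<X>" by auto
    have "eval_tensor (cov_deriv A D r (Ws ! j) \<phi>) (scale_field f U # take j Ws @ drop (Suc j) Ws) p =
        f p * eval_tensor (cov_deriv A D r (Ws ! j) \<phi>) (U # take j Ws @ drop (Suc j) Ws) p"
      if "j < r" for j p
    proof (rule sym_multilinear_scale[OF C])
      show "set (take j Ws @ drop (Suc j) Ws) \<subseteq> \<X>"
        using H(4) set_take_drop_subset[of j Ws "Suc j"] by blast
    qed (use H that in auto)
    then show "sym_deriv_form r \<phi> (scale_field f U # Ws) = (\<lambda>p. f p * sym_deriv_form r \<phi> (U # Ws) p)"
      using eval_cov_deriv_scale[OF \<phi> H(2,3,1,4)]
      by (intro ext) (simp add: sym_deriv_form_Cons sum_distrib_left algebra_simps)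
  }
qed

lemma sym_deriv:
  assumes "\<phi> \<in> sym_tensors A r"
  shows sym_deriv_sym_tensor: "sym_deriv A D r \<phi> \<in> sym_tensors A (Suc r)"
    and eval_sym_deriv: "\<And>Xs p. length Xs = Suc r \<Longrightarrow> set Xs \<subseteq> \<X> \<Longrightarrow>
      eval_tensor (sym_deriv A D r \<phi>) Xs p = sym_deriv_form r \<phi> Xs p"
  using theI'[OF sym_multilinear_imp_tensor[OF M sym_deriv_form_sym_multilinear[OF assms]]]
  unfolding sym_deriv_def sym_deriv_form_def[abs_def] by blast+

end

section \<open>Graded tensor fields and the symmetric Lie derivative\<close>

lemma zero_sym_tensor: "0 \<in> sym_tensors A r"
  by (auto simp: sym_tensors_def sym_forms_def eval_tensor_def smooth_const)

lemma eval_tensor_diff: "eval_tensor (\<phi> - \<psi>) Xs p = eval_tensor \<phi> Xs p - eval_tensor \<psi> Xs p"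
  by (simp add: eval_tensor_def)

lemma diff_sym_tensor:
  assumes M: "smooth_manifold A" and "\<phi> \<in> sym_tensors A r" "\<psi> \<in> sym_tensors A r"
  shows "\<phi> - \<psi> \<in> sym_tensors A r"
  unfolding sym_tensors_def
proof (intro CollectI conjI allI impI)
  note F = sym_tensor_form[OF assms(2)] sym_tensor_form[OF assms(3)]
  show "(\<phi> - \<psi>) p \<in> sym_forms A r p" for p
  proof (rule sym_forms_I)
    fix vs ws assume "length vs = r" "set vs \<subseteq> tangent_space A p" "mset ws = mset vs"
    then show "(\<phi> - \<psi>) p ws = (\<phi> - \<psi>) p vs"
      using sym_form_perm[OF F(1), of vs p ws] sym_form_perm[OF F(2), of vs p ws] by simp
  next
    fix vs assume "\<not> (length vs = r \<and> set vs \<subseteq> tangent_space A p)"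
    then show "(\<phi> - \<psi>) p vs = 0"
      using sym_form_zero[OF F(1), of vs p] sym_form_zero[OF F(2), of vs p] by simp
  qed (simp add: sym_form_head[OF F(1)] sym_form_head[OF F(2)] algebra_simps)
  fix Xs assume Xs: "length Xs = r \<and> set Xs \<subseteq> vector_fields A"
  have "eval_tensor (\<phi> - \<psi>) Xs = (\<lambda>p. eval_tensor \<phi> Xs p - eval_tensor \<psi> Xs p)"
    by (simp add: fun_eq_iff eval_tensor_diff)
  then show "eval_tensor (\<phi> - \<psi>) Xs \<in> smooth_functions A"
    using Xs by (simp add: smooth_diff[OF M]
        sym_multilinear_smooth[OF eval_tensor_sym_multilinear[OF assms(2)]]
        sym_multilinear_smooth[OF eval_tensor_sym_multilinear[OF assms(3)]])
qed

lemma iota_sym_tensor: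
  assumes "\<phi> \<in> sym_tensors A (Suc r)" "X \<in> vector_fields A"
  shows "(\<lambda>p vs. \<phi> p (X p # vs)) \<in> sym_tensors A r"
  unfolding sym_tensors_def
proof (intro CollectI conjI allI impI)
  note F = sym_tensor_form[OF assms(1)]
  note X = vector_field_tangent[OF assms(2)]
  show "(\<lambda>vs. \<phi> p (X p # vs)) \<in> sym_forms A r p" for p
  proof (rule sym_forms_I)
    fix vs u w and a b :: real
    assume vs: "Suc (length vs) = r" "set vs \<subseteq> tangent_space A p"
      and uw: "u \<in> tangent_space A p" "w \<in> tangent_space A p"
    have swap: "\<phi> p (X p # z # vs) = \<phi> p (z # X p # vs)" if "z \<in> tangent_space A p" for z
      by (rule sym_form_perm[OF F]) (use vs X that in auto)
    show "\<phi> p (X p # (\<lambda>f. a * u f + b * w f) # vs) = a * \<phi> p (X p # u # vs) + b * \<phi> p (X p # w # vs)"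
      using sym_form_head[OF F, of "X p # vs" p u w a b] vs uw X tangent_space_lincomb[OF uw]
      by (simp add: swap)
  next
    fix vs ws assume "length vs = r" "set vs \<subseteq> tangent_space A p" "mset ws = mset vs"
    then show "\<phi> p (X p # ws) = \<phi> p (X p # vs)"
      using X by (intro sym_form_perm[OF F]) auto
  qed (rule sym_form_zero[OF F], auto)
  fix Xs assume "length Xs = r \<and> set Xs \<subseteq> vector_fields A"
  then show "eval_tensor (\<lambda>p vs. \<phi> p (X p # vs)) Xs \<in> smooth_functions A"
    using sym_multilinear_smooth[OF eval_tensor_sym_multilinear[OF assms(1)], of "X # Xs"] assms(2)
    by (simp add: eval_tensor_def)
qed

lemma eval_iota: "eval_tensor (iota X \<Phi> r) Ys p = eval_tensor (\<Phi> (Suc r)) (X # Ys) p"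
  by (simp add: eval_tensor_def iota_def)

lemma iota_diff: "iota X (\<Phi> - \<Psi>) = iota X \<Phi> - iota X \<Psi>"
  by (simp add: iota_def fun_eq_iff)

text \<open>On smooth functions this is cancellation of triple derivatives; on the other functions both sides
  vanish by the normalisation of tangent vectors.\<close>

lemma lie_bracket_Jacobi:
  assumes M: "smooth_manifold A"
    and XYZ: "X \<in> vector_fields A" "Y \<in> vector_fields A" "Z \<in> vector_fields A"
  shows "lie_bracket X (lie_bracket Y Z) = lie_bracket (lie_bracket X Y) Z + lie_bracket Y (lie_bracket X Z)"
proof (intro ext)
  fix p f
  show "lie_bracket X (lie_bracket Y Z) p f =
      (lie_bracket (lie_bracket X Y) Z + lie_bracket Y (lie_bracket X Z)) p f"
  proof (cases "f \<in> smooth_functions A")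
    case True
    note s = vector_field_smooth[OF XYZ(1)] vector_field_smooth[OF XYZ(2)] vector_field_smooth[OF XYZ(3)]
    note d = tangent_diff[OF vector_field_tangent[OF XYZ(1)]]
      tangent_diff[OF vector_field_tangent[OF XYZ(2)]] tangent_diff[OF vector_field_tangent[OF XYZ(3)]]
    show ?thesis using True by (simp add: lie_bracket_def d s)
  next
    case False
    then show ?thesis
      using vector_field_nonsmooth[OF XYZ(1)] vector_field_nonsmooth[OF XYZ(2)] vector_field_nonsmooth[OF XYZ(3)]
        tangent_const[OF vector_field_tangent[OF XYZ(1)], where c = 0] tangent_const[OF vector_field_tangent[OF XYZ(2)], where c = 0]
        tangent_const[OF vector_field_tangent[OF XYZ(3)], where c = 0]
      by (simp add: lie_bracket_def)
  qed
qed

text \<open>The direct product over all degrees. It contains \<^const>\<open>sym_tensors_sum\<close> and is closed under all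
  the operators, which act degree by degree.\<close>

definition graded_tensors :: "('a, 'e::euclidean_space) atlas \<Rightarrow> 'a graded set" where
  "graded_tensors A = {\<Phi>. \<forall>r. \<Phi> r \<in> sym_tensors A r}"

lemma graded_tensors_component: "\<Phi> \<in> graded_tensors A \<Longrightarrow> \<Phi> r \<in> sym_tensors A r"
  by (simp add: graded_tensors_def)

lemma graded_tensors_eqI:
  assumes "smooth_manifold A" "\<Phi> \<in> graded_tensors A" "\<Psi> \<in> graded_tensors A"
    and "\<And>r Xs p. length Xs = r \<Longrightarrow> set Xs \<subseteq> vector_fields A \<Longrightarrow>
      eval_tensor (\<Phi> r) Xs p = eval_tensor (\<Psi> r) Xs p"
  shows "\<Phi> = \<Psi>"
proof
  show "\<Phi> r = \<Psi> r" for r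
    using assms by (intro sym_tensor_eqI[OF assms(1), of _ r]) (auto simp: graded_tensors_def)
qed

lemma graded_tensors_diff:
  "smooth_manifold A \<Longrightarrow> \<Phi> \<in> graded_tensors A \<Longrightarrow> \<Psi> \<in> graded_tensors A \<Longrightarrow> \<Phi> - \<Psi> \<in> graded_tensors A"
  by (simp add: graded_tensors_def diff_sym_tensor)

lemma graded_tensors_iota:
  "\<Phi> \<in> graded_tensors A \<Longrightarrow> X \<in> vector_fields A \<Longrightarrow> iota X \<Phi> \<in> graded_tensors A"
  by (simp add: graded_tensors_def iota_def iota_sym_tensor)

lemma sym_tensors_sum_graded: "\<Phi> \<in> sym_tensors_sum A \<Longrightarrow> \<Phi> \<in> graded_tensors A"
  by (simp add: sym_tensors_sum_def graded_tensors_def)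

lemma sym_tensors_sum_iota:
  assumes "\<Phi> \<in> sym_tensors_sum A" "X \<in> vector_fields A"
  shows "iota X \<Phi> \<in> sym_tensors_sum A"
proof -
  have "iota X \<Phi> r = 0" if "\<Phi> (Suc r) = 0" for r
    using that by (simp add: iota_def zero_fun_def)
  then have "{r. iota X \<Phi> r \<noteq> 0} \<subseteq> Suc -` {r. \<Phi> r \<noteq> 0}" by auto
  moreover have "finite (Suc -` {r. \<Phi> r \<noteq> 0})"
    using assms(1) by (intro finite_vimageI) (auto simp: sym_tensors_sum_def)
  ultimately have "finite {r. iota X \<Phi> r \<noteq> 0}" by (rule finite_subset)
  then show ?thesis
    using graded_tensors_iota[OF sym_tensors_sum_graded[OF assms(1)] assms(2)]
    by (simp add: sym_tensors_sum_def graded_tensors_def)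
qed

lemma homogeneous_sym_tensors_sum:
  assumes "\<phi> \<in> sym_tensors A r"
  shows "(\<lambda>k. if k = r then \<phi> else 0) \<in> sym_tensors_sum A"
proof -
  have "finite {k. (if k = r then \<phi> else 0) \<noteq> 0}" by (rule finite_subset[of _ "{r}"]) auto
  then show ?thesis using assms by (simp add: sym_tensors_sum_def zero_sym_tensor)
qed

context affine_manifold
begin

lemma sym_bracket_closed: "X \<in> \<X> \<Longrightarrow> Y \<in> \<X> \<Longrightarrow> sym_bracket D X Y \<in> \<X>"
  unfolding sym_bracket_def by (intro add_in_vector_fields[OF M] connection_closed)

lemma graded_tensors_Nabla: "\<Phi> \<in> graded_tensors A \<Longrightarrow> Nabla_s A D \<Phi> \<in> graded_tensors A"
  by (simp add: graded_tensors_def Nabla_s_def zero_sym_tensor sym_deriv_sym_tensor split: nat.split)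

lemma graded_tensors_Lie: "\<Phi> \<in> graded_tensors A \<Longrightarrow> X \<in> \<X> \<Longrightarrow> sym_Lie A D X \<Phi> \<in> graded_tensors A"
  unfolding sym_Lie_def
  by (intro graded_tensors_diff[OF M] graded_tensors_iota graded_tensors_Nabla)

lemma cov_form_diff:
  assumes "\<phi> \<in> sym_tensors A r" "\<psi> \<in> sym_tensors A r" "X \<in> \<X>" "length Ys = r" "set Ys \<subseteq> \<X>"
  shows "cov_form r X (\<phi> - \<psi>) Ys p = cov_form r X \<phi> Ys p - cov_form r X \<psi> Ys p"
proof -
  have "eval_tensor (\<phi> - \<psi>) Ys = (\<lambda>p. eval_tensor \<phi> Ys p - eval_tensor \<psi> Ys p)"
    by (simp add: fun_eq_iff eval_tensor_diff)
  then have "X p (eval_tensor (\<phi> - \<psi>) Ys) = X p (eval_tensor \<phi> Ys) - X p (eval_tensor \<psi> Ys)"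
    using assms
    by (simp add: tangent_diff[OF vector_field_tangent[OF assms(3)]]
        sym_multilinear_smooth[OF eval_tensor_sym_multilinear[OF assms(1)]]
        sym_multilinear_smooth[OF eval_tensor_sym_multilinear[OF assms(2)]])
  then show ?thesis by (simp add: cov_form_def eval_tensor_diff sum_subtractf)
qed

lemma sym_deriv_diff:
  assumes "\<phi> \<in> sym_tensors A r" "\<psi> \<in> sym_tensors A r"
  shows "sym_deriv A D r (\<phi> - \<psi>) = sym_deriv A D r \<phi> - sym_deriv A D r \<psi>"
proof (rule sym_tensor_eqI[OF M])
  note d = diff_sym_tensor[OF M assms]
  show "sym_deriv A D r (\<phi> - \<psi>) \<in> sym_tensors A (Suc r)"
    "sym_deriv A D r \<phi> - sym_deriv A D r \<psi> \<in> sym_tensors A (Suc r)"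
    using assms d by (auto intro: diff_sym_tensor[OF M] sym_deriv_sym_tensor)
  fix Xs p assume Xs: "length Xs = Suc r" "set Xs \<subseteq> \<X>"
  have "eval_tensor (cov_deriv A D r (Xs ! j) (\<phi> - \<psi>)) (take j Xs @ drop (Suc j) Xs) p =
      eval_tensor (cov_deriv A D r (Xs ! j) \<phi>) (take j Xs @ drop (Suc j) Xs) p -
      eval_tensor (cov_deriv A D r (Xs ! j) \<psi>) (take j Xs @ drop (Suc j) Xs) p" if "j < Suc r" for j
  proof -
    have "Xs ! j \<in> \<X>" using Xs that by auto
    moreover have "set (take j Xs @ drop (Suc j) Xs) \<subseteq> \<X>"
      using Xs(2) set_take_drop_subset[of j Xs "Suc j"] by blast
    moreover have "length (take j Xs @ drop (Suc j) Xs) = r" using Xs(1) that by simp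
    ultimately show ?thesis
      using assms d by (simp add: eval_cov_deriv cov_form_diff del: set_append)
  qed
  then show "eval_tensor (sym_deriv A D r (\<phi> - \<psi>)) Xs p =
      eval_tensor (sym_deriv A D r \<phi> - sym_deriv A D r \<psi>) Xs p"
    using Xs assms d
    by (simp add: eval_sym_deriv eval_tensor_diff sym_deriv_form_def sum_subtractf del: sum.lessThan_Suc)
qed

lemma Nabla_diff:
  assumes "\<Phi> \<in> graded_tensors A" "\<Psi> \<in> graded_tensors A"
  shows "Nabla_s A D (\<Phi> - \<Psi>) = Nabla_s A D \<Phi> - Nabla_s A D \<Psi>"
proof
  fix r
  show "Nabla_s A D (\<Phi> - \<Psi>) r = (Nabla_s A D \<Phi> - Nabla_s A D \<Psi>) r"
    using assms by (cases r) (auto simp: Nabla_s_def sym_deriv_diff graded_tensors_def)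
qed

lemma Lie_diff:
  assumes "\<Phi> \<in> graded_tensors A" "\<Psi> \<in> graded_tensors A" "X \<in> \<X>"
  shows "sym_Lie A D X (\<Phi> - \<Psi>) = sym_Lie A D X \<Phi> - sym_Lie A D X \<Psi>"
  using assms by (simp add: sym_Lie_def iota_diff Nabla_diff graded_tensors_iota)

text \<open>In \<open>\<iota>\<^sub>X \<nabla>\<^sup>s \<phi>\<close> and \<open>\<nabla>\<^sup>s \<iota>\<^sub>X \<phi>\<close> the terms differentiated along \<open>Zs ! j\<close> agree except for \<open>\<phi>\<close> with
  \<open>D (Zs ! j) X\<close> in slot \<open>j\<close>, which comes from differentiating the argument \<open>X\<close>. With the term in
  \<open>D X (Zs ! j)\<close> from the covariant derivative along \<open>X\<close> it forms the symmetric bracket.\<close>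

lemma eval_Lie:
  assumes \<Phi>: "\<Phi> \<in> graded_tensors A" and X: "X \<in> \<X>" and Zs: "length Zs = r" "set Zs \<subseteq> \<X>"
  shows "eval_tensor (sym_Lie A D X \<Phi> r) Zs p = X p (eval_tensor (\<Phi> r) Zs) -
    (\<Sum>j<r. eval_tensor (\<Phi> r) (Zs[j := sym_bracket D X (Zs ! j)]) p)"
proof -
  note \<phi> = graded_tensors_component[OF \<Phi>, of r]
  note T = eval_tensor_sym_multilinear[OF \<phi>]
  let ?e = "eval_tensor (\<Phi> r)" and ?R = "\<lambda>j. take j Zs @ drop (Suc j) Zs"
  have Zj: "Zs ! j \<in> \<X>" "set (?R j) \<subseteq> \<X>" if "j < r" for j
    using Zs that set_take_drop_subset[of j Zs "Suc j"] by auto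
  have "eval_tensor (iota X (Nabla_s A D \<Phi>) r) Zs p = sym_deriv_form r (\<Phi> r) (X # Zs) p"
    using \<phi> X Zs by (simp add: eval_iota Nabla_s_def eval_sym_deriv)
  also have "\<dots> = cov_form r X (\<Phi> r) Zs p +
      (\<Sum>j<r. eval_tensor (cov_deriv A D r (Zs ! j) (\<Phi> r)) (X # ?R j) p)"
    using \<phi> X Zs by (simp add: sym_deriv_form_Cons eval_cov_deriv)
  finally have 1: "eval_tensor (iota X (Nabla_s A D \<Phi>) r) Zs p = \<dots>" .
  have 2: "eval_tensor (Nabla_s A D (iota X \<Phi>) r) Zs p =
      (\<Sum>j<r. eval_tensor (cov_deriv A D r (Zs ! j) (\<Phi> r)) (X # ?R j) p + ?e (D (Zs ! j) X # ?R j) p)"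
  proof (cases r)
    case 0
    then show ?thesis by (simp add: Nabla_s_def eval_tensor_def)
  next
    case (Suc k)
    note \<iota> = graded_tensors_component[OF graded_tensors_iota[OF \<Phi> X], of k]
    have "eval_tensor (cov_deriv A D k (Zs ! j) (iota X \<Phi> k)) (?R j) p =
        eval_tensor (cov_deriv A D r (Zs ! j) (\<Phi> r)) (X # ?R j) p + ?e (D (Zs ! j) X # ?R j) p"
      if j: "j < r" for j
    proof -
      have len: "length (?R j) = k" "length (X # ?R j) = Suc k" using j Suc Zs(1) by auto
      have "eval_tensor (iota X \<Phi> k) (?R j) = eval_tensor (\<Phi> (Suc k)) (X # ?R j)"
        by (simp add: fun_eq_iff eval_iota)
      then show ?thesis
        using Zj[OF j] len X \<phi> \<iota> unfolding Suc
        by (simp add: eval_cov_deriv cov_form_Cons del: set_append) (simp add: cov_form_def eval_iota)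
    qed
    then show ?thesis
      using Zs \<iota> Suc by (simp add: Nabla_s_def eval_sym_deriv sym_deriv_form_def del: sum.lessThan_Suc)
  qed
  have 3: "?e (Zs[j := sym_bracket D X (Zs ! j)]) p = ?e (Zs[j := D X (Zs ! j)]) p + ?e (D (Zs ! j) X # ?R j) p"
    if "j < r" for j
  proof -
    have "D X (Zs ! j) \<in> \<X>" "D (Zs ! j) X \<in> \<X>"
      using Zj[OF that] X by (auto intro: connection_closed)
    then show ?thesis
      unfolding sym_bracket_def
      by (simp add: sym_multilinear_slot_add[OF T Zs that] add_in_vector_fields[OF M]
          sym_multilinear_slot[OF T Zs that, of "D (Zs ! j) X"])
  qed
  show ?thesis
    by (simp add: sym_Lie_def eval_tensor_diff 1 2 cov_form_def 3 sum.distrib)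
qed

lemma iota_add:
  assumes "\<Phi> \<in> graded_tensors A" "U \<in> \<X>" "V \<in> \<X>"
  shows "iota (U + V) \<Phi> = iota U \<Phi> + iota V \<Phi>"
proof (intro ext)
  fix r p vs
  note F = sym_tensor_form[OF graded_tensors_component[OF assms(1)], of "Suc r" p]
  have UV: "(U + V) p = (\<lambda>f. 1 * U p f + 1 * V p f)" by (simp add: fun_eq_iff)
  show "iota (U + V) \<Phi> r p vs = (iota U \<Phi> + iota V \<Phi>) r p vs"
  proof (cases "length vs = r \<and> set vs \<subseteq> tangent_space A p")
    case True
    then show ?thesis
      unfolding iota_def UV using sym_form_head[OF F, of vs "U p" "V p" 1 1] assms
      by (simp add: vector_field_tangent)
  next
    case False
    then have "\<Phi> (Suc r) p (z # vs) = 0" for z by (intro sym_form_zero[OF F]) auto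
    then show ?thesis by (simp add: iota_def)
  qed
qed

text \<open>Comparing the two evaluations, only the slot occupied by \<open>Y\<close> survives.\<close>

lemma Lie_iota:
  assumes \<Phi>: "\<Phi> \<in> graded_tensors A" and X: "X \<in> \<X>" and Y: "Y \<in> \<X>"
  shows "sym_Lie A D X (iota Y \<Phi>) = iota Y (sym_Lie A D X \<Phi>) + iota (sym_bracket D X Y) \<Phi>"
proof -
  have "sym_Lie A D X (iota Y \<Phi>) - iota Y (sym_Lie A D X \<Phi>) = iota (sym_bracket D X Y) \<Phi>"
  proof (rule graded_tensors_eqI[OF M])
    fix r Zs p assume Zs: "length Zs = r" "set Zs \<subseteq> \<X>"
    have "eval_tensor (iota Y \<Phi> r) Zs = eval_tensor (\<Phi> (Suc r)) (Y # Zs)"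
      by (simp add: fun_eq_iff eval_iota)
    then have "eval_tensor (sym_Lie A D X (iota Y \<Phi>) r) Zs p = X p (eval_tensor (\<Phi> (Suc r)) (Y # Zs)) -
        (\<Sum>j<r. eval_tensor (\<Phi> (Suc r)) (Y # Zs[j := sym_bracket D X (Zs ! j)]) p)"
      using eval_Lie[OF graded_tensors_iota[OF \<Phi> Y] X Zs, of p] by (simp add: eval_iota)
    moreover have "eval_tensor (iota Y (sym_Lie A D X \<Phi>) r) Zs p =
        X p (eval_tensor (\<Phi> (Suc r)) (Y # Zs)) - eval_tensor (\<Phi> (Suc r)) (sym_bracket D X Y # Zs) p -
        (\<Sum>j<r. eval_tensor (\<Phi> (Suc r)) (Y # Zs[j := sym_bracket D X (Zs ! j)]) p)"
      using eval_Lie[OF \<Phi> X, of "Y # Zs" "Suc r" p] Zs Y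
      by (simp add: eval_iota sum.lessThan_Suc_shift del: sum.lessThan_Suc)
    ultimately show "eval_tensor ((sym_Lie A D X (iota Y \<Phi>) - iota Y (sym_Lie A D X \<Phi>)) r) Zs p =
        eval_tensor (iota (sym_bracket D X Y) \<Phi> r) Zs p"
      by (simp add: eval_tensor_diff eval_iota)
  qed (intro graded_tensors_diff[OF M] graded_tensors_Lie graded_tensors_iota sym_bracket_closed \<Phi> X Y)+
  then show ?thesis by (simp add: algebra_simps)
qed

lemma Nabla_iota: "Nabla_s A D (iota X \<Phi>) = iota X (Nabla_s A D \<Phi>) - sym_Lie A D X \<Phi>"
  by (simp add: sym_Lie_def)

end

section \<open>Commutators with contractions and parallel affine fields\<close>

context affine_manifold
begin

text \<open>The failure of \<open>X \<mapsto> L\<^sub>X\<close> to be compatible with the symmetric bracket; this is \<open>K\<^sub>X\<^sub>Y\<close> above.\<close>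

definition Lie_defect :: "'a vfield \<Rightarrow> 'a vfield \<Rightarrow> 'a graded \<Rightarrow> 'a graded" where
  "Lie_defect X Y \<Phi> =
     commutator (sym_Lie A D X) (sym_Lie A D Y) \<Phi> - sym_Lie A D (sym_bracket D X Y) \<Phi>"

text \<open>The Jacobi identity for commutators, with \<open>[L\<^sub>U, \<iota>\<^sub>V]\<close> replaced by the contraction with \<open>[U, V]\<^sub>s\<close>.\<close>

lemma Lie_defect_iota:
  assumes \<Phi>: "\<Phi> \<in> graded_tensors A" and X: "X \<in> \<X>" and Y: "Y \<in> \<X>" and Z: "Z \<in> \<X>"
  shows "Lie_defect X Y (iota Z \<Phi>) = iota Z (Lie_defect X Y \<Phi>) +
    (iota (sym_bracket D X (sym_bracket D Y Z)) \<Phi> - iota (sym_bracket D Y (sym_bracket D X Z)) \<Phi>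
      - iota (sym_bracket D (sym_bracket D X Y) Z) \<Phi>)"
proof -
  have double: "sym_Lie A D U (sym_Lie A D V (iota Z \<Phi>)) = iota Z (sym_Lie A D U (sym_Lie A D V \<Phi>)) +
      iota (sym_bracket D U Z) (sym_Lie A D V \<Phi>) + iota (sym_bracket D V Z) (sym_Lie A D U \<Phi>) +
      iota (sym_bracket D U (sym_bracket D V Z)) \<Phi>" if "U \<in> \<X>" "V \<in> \<X>" for U V
  proof -
    have "iota Z (sym_Lie A D V \<Phi>) = sym_Lie A D V (iota Z \<Phi>) - iota (sym_bracket D V Z) \<Phi>"
      using \<Phi> Z that by (simp add: Lie_iota)
    then have "sym_Lie A D U (iota Z (sym_Lie A D V \<Phi>)) =
        sym_Lie A D U (sym_Lie A D V (iota Z \<Phi>)) - sym_Lie A D U (iota (sym_bracket D V Z) \<Phi>)"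
      using \<Phi> Z that
      by (simp only:) (intro Lie_diff graded_tensors_Lie graded_tensors_iota sym_bracket_closed)
    then show ?thesis
      using \<Phi> Z that by (simp add: Lie_iota graded_tensors_Lie sym_bracket_closed algebra_simps)
  qed
  show ?thesis
    unfolding Lie_defect_def commutator_def double[OF X Y] double[OF Y X]
      Lie_iota[OF \<Phi> sym_bracket_closed[OF X Y] Z] iota_diff
    by (simp add: algebra_simps)
qed

text \<open>The Jacobi identity for commutators, with \<open>[\<nabla>\<^sup>s, \<iota>\<^sub>Z] = - L\<^sub>Z\<close>. It links the sixth relation to the
  fifth one.\<close>

lemma commutator_Nabla_Lie_iota:
  assumes \<Phi>: "\<Phi> \<in> graded_tensors A" and X: "X \<in> \<X>" and Z: "Z \<in> \<X>"
  shows "commutator (Nabla_s A D) (sym_Lie A D X) (iota Z \<Phi>) =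
    iota Z (commutator (Nabla_s A D) (sym_Lie A D X) \<Phi>) + Lie_defect X Z \<Phi>"
proof -
  note closed = graded_tensors_Lie graded_tensors_iota graded_tensors_Nabla sym_bracket_closed
  have "iota Z (sym_Lie A D X \<Phi>) = sym_Lie A D X (iota Z \<Phi>) - iota (sym_bracket D X Z) \<Phi>"
    using \<Phi> X Z by (simp add: Lie_iota)
  then have "Nabla_s A D (iota Z (sym_Lie A D X \<Phi>)) =
      Nabla_s A D (sym_Lie A D X (iota Z \<Phi>)) - Nabla_s A D (iota (sym_bracket D X Z) \<Phi>)"
    using \<Phi> X Z by (simp only:) (intro Nabla_diff closed)
  then have 1: "Nabla_s A D (sym_Lie A D X (iota Z \<Phi>)) = iota Z (Nabla_s A D (sym_Lie A D X \<Phi>)) -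
      sym_Lie A D Z (sym_Lie A D X \<Phi>) + iota (sym_bracket D X Z) (Nabla_s A D \<Phi>) -
      sym_Lie A D (sym_bracket D X Z) \<Phi>"
    by (simp add: Nabla_iota algebra_simps)
  have "sym_Lie A D X (Nabla_s A D (iota Z \<Phi>)) =
      sym_Lie A D X (iota Z (Nabla_s A D \<Phi>)) - sym_Lie A D X (sym_Lie A D Z \<Phi>)"
    unfolding Nabla_iota using \<Phi> X Z by (intro Lie_diff) (auto intro: closed)
  then have 2: "sym_Lie A D X (Nabla_s A D (iota Z \<Phi>)) = iota Z (sym_Lie A D X (Nabla_s A D \<Phi>)) +
      iota (sym_bracket D X Z) (Nabla_s A D \<Phi>) - sym_Lie A D X (sym_Lie A D Z \<Phi>)"
    using \<Phi> X Z by (simp add: Lie_iota closed)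
  show ?thesis
    unfolding commutator_def Lie_defect_def 1 2 iota_diff by (simp add: algebra_simps)
qed

lemma eval_Lie_function:
  assumes "\<Phi> \<in> graded_tensors A" "X \<in> \<X>"
  shows "eval_tensor (sym_Lie A D X \<Phi> 0) [] = (\<lambda>p. X p (eval_tensor (\<Phi> 0) []))"
  using eval_Lie[OF assms, of "[]" 0] by (simp add: fun_eq_iff)

lemma eval_Lie_defect_function:
  assumes "\<Phi> \<in> graded_tensors A" "X \<in> \<X>" "Y \<in> \<X>"
  shows "eval_tensor (Lie_defect X Y \<Phi> 0) [] p =
    (lie_bracket X Y - sym_bracket D X Y) p (eval_tensor (\<Phi> 0) [])"
  using assms unfolding Lie_defect_def commutator_def
  by (simp add: eval_tensor_diff eval_Lie_function graded_tensors_Lie sym_bracket_closed lie_bracket_def)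

text \<open>Induction on the number of arguments: contracting \<open>P \<Phi>\<close> with the first argument reduces to
  \<open>P (iota Z \<Phi>)\<close> and one argument less.\<close>

lemma operator_vanishes_by_iota:
  assumes G: "\<And>\<Phi>. \<Phi> \<in> graded_tensors A \<Longrightarrow> P \<Phi> \<in> graded_tensors A"
    and iota: "\<And>\<Phi> Z. \<Phi> \<in> graded_tensors A \<Longrightarrow> Z \<in> \<X> \<Longrightarrow> iota Z (P \<Phi>) = P (iota Z \<Phi>)"
    and zero: "\<And>\<Phi> p. \<Phi> \<in> graded_tensors A \<Longrightarrow> eval_tensor (P \<Phi> 0) [] p = 0"
    and \<Phi>: "\<Phi> \<in> graded_tensors A"
  shows "P \<Phi> = 0"
proof (rule graded_tensors_eqI[OF M G[OF \<Phi>]])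
  show "0 \<in> graded_tensors A" by (simp add: graded_tensors_def zero_sym_tensor)
  fix r Xs p assume "length Xs = r" "set Xs \<subseteq> \<X>"
  with \<Phi> have "eval_tensor (P \<Phi> r) Xs p = 0"
  proof (induction Xs arbitrary: r \<Phi>)
    case Nil
    then show ?case using zero by simp
  next
    case (Cons Z Zs)
    then have "eval_tensor (P \<Phi> r) (Z # Zs) p = eval_tensor (iota Z (P \<Phi>) (length Zs)) Zs p"
      by (simp add: eval_iota)
    also have "\<dots> = eval_tensor (P (iota Z \<Phi>) (length Zs)) Zs p"
      using Cons.prems by (simp add: iota)
    also have "\<dots> = 0" using Cons.prems by (intro Cons.IH graded_tensors_iota) auto
    finally show ?case .
  qed
  then show "eval_tensor (P \<Phi> r) Xs p = eval_tensor (0 r) Xs p" by (simp add: eval_tensor_def)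
qed

lemma connection_diff_right:
  assumes "X \<in> \<X>" "Y \<in> \<X>" "Y' \<in> \<X>"
  shows "D X (Y - Y') = D X Y - D X Y'"
proof -
  have "D X Y = D X ((Y - Y') + Y')" by (simp only: diff_add_cancel)
  also have "\<dots> = D X (Y - Y') + D X Y'"
    using assms by (intro connection_add_right diff_in_vector_fields M)
  finally show ?thesis by (simp only: add_diff_cancel_right')
qed

end

locale torsion_free_manifold = affine_manifold +
  assumes torsion_free: "torsion_free A D"
begin

lemma lie_bracket_eq: "X \<in> \<X> \<Longrightarrow> Y \<in> \<X> \<Longrightarrow> lie_bracket X Y = D X Y - D Y X"
  using torsion_free by (simp add: torsion_free_def)

definition curvature :: "'a vfield \<Rightarrow> 'a vfield \<Rightarrow> 'a vfield \<Rightarrow> 'a vfield" where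
  "curvature X Y Z = D X (D Y Z) - D Y (D X Z) - D (lie_bracket X Y) Z"

lemma parallel_brackets:
  assumes "X \<in> \<X>" "\<forall>Z\<in>\<X>. D Z X = 0" "Z \<in> \<X>"
  shows "lie_bracket X Z = D X Z" "sym_bracket D X Z = D X Z"
  using assms lie_bracket_eq[of X Z] by (simp_all add: sym_bracket_def)

text \<open>For parallel \<open>X\<close> the difference of the two sides is the Jacobi expression of \<open>X\<close>, \<open>Y\<close>, \<open>Z\<close>. It is the first
  Bianchi identity combined with \<open>R(Y, Z) X = 0\<close>.\<close>

lemma curvature_parallel_sym:
  assumes X: "X \<in> \<X>" "\<forall>Z\<in>\<X>. D Z X = 0" and YZ: "Y \<in> \<X>" "Z \<in> \<X>"
  shows "curvature X Y Z = curvature X Z Y"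
proof -
  note c = connection_closed
  have b: "lie_bracket U V = D U V - D V U" "lie_bracket U V \<in> \<X>" if "U \<in> \<X>" "V \<in> \<X>" for U V
    using that lie_bracket_eq by (auto intro: diff_in_vector_fields[OF M] c)
  have j1: "lie_bracket X (lie_bracket Y Z) = D X (D Y Z) - D X (D Z Y)"
    unfolding parallel_brackets(1)[OF X b(2)[OF YZ]] unfolding b(1)[OF YZ]
    by (intro connection_diff_right c X YZ)
  have j2: "lie_bracket (lie_bracket X Y) Z = D (D X Y) Z - D Z (D X Y)"
    unfolding parallel_brackets(1)[OF X YZ(1)] by (intro b(1) c X YZ)
  have j3: "lie_bracket Y (lie_bracket X Z) = D Y (D X Z) - D (D X Z) Y"
    unfolding parallel_brackets(1)[OF X YZ(2)] by (intro b(1) c X YZ)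
  have "curvature X Y Z - curvature X Z Y = lie_bracket X (lie_bracket Y Z) -
      lie_bracket (lie_bracket X Y) Z - lie_bracket Y (lie_bracket X Z)"
    unfolding j1 j2 j3
    unfolding curvature_def parallel_brackets(1)[OF X YZ(1)] parallel_brackets(1)[OF X YZ(2)]
    by (simp add: algebra_simps)
  also have "\<dots> = 0"
    unfolding lie_bracket_Jacobi[OF M X(1) YZ] by (simp add: algebra_simps)
  finally show ?thesis by (simp only: right_minus_eq)
qed

lemma curvature_sym_bracket:
  assumes X: "X \<in> \<X>" "\<forall>Z\<in>\<X>. D Z X = 0" and YZ: "Y \<in> \<X>" "Z \<in> \<X>"
  shows "sym_bracket D X (sym_bracket D Y Z) - sym_bracket D Y (sym_bracket D X Z)
    - sym_bracket D (sym_bracket D X Y) Z = curvature X Y Z + curvature X Z Y"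
proof -
  note c = connection_closed
  have sXYZ: "sym_bracket D X (sym_bracket D Y Z) = D X (D Y Z) + D X (D Z Y)"
    using X YZ c by (simp only: parallel_brackets(2)[OF X] sym_bracket_closed)
      (simp only: sym_bracket_def connection_add_right c X YZ)
  show ?thesis
    unfolding sXYZ parallel_brackets(2)[OF X YZ(1)] parallel_brackets(2)[OF X YZ(2)]
    unfolding curvature_def parallel_brackets(1)[OF X YZ(1)] parallel_brackets(1)[OF X YZ(2)]
    unfolding sym_bracket_def by (simp add: algebra_simps)
qed

text \<open>For parallel \<open>X\<close> being affine means \<open>curvature X Y Z = 0\<close>, and the bracket condition means that twice
  this vector field is zero.\<close>

lemma aff0_iff:
  assumes X: "X \<in> \<X>"
  shows "X \<in> aff0 A D \<longleftrightarrow> (\<forall>Z\<in>\<X>. D Z X = 0) \<and> (\<forall>Y\<in>\<X>. \<forall>Z\<in>\<X>.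
    sym_bracket D X (sym_bracket D Y Z) =
    sym_bracket D Y (sym_bracket D X Z) + sym_bracket D (sym_bracket D X Y) Z)"
proof (cases "\<forall>Z\<in>\<X>. D Z X = 0")
  case True
  have "lie_bracket X (D Y Z) - D Y (lie_bracket X Z) = D (lie_bracket X Y) Z \<longleftrightarrow>
      sym_bracket D X (sym_bracket D Y Z) =
      sym_bracket D Y (sym_bracket D X Z) + sym_bracket D (sym_bracket D X Y) Z"
    if YZ: "Y \<in> \<X>" "Z \<in> \<X>" for Y Z
  proof -
    have "lie_bracket X (D Y Z) - D Y (lie_bracket X Z) = D (lie_bracket X Y) Z \<longleftrightarrow> curvature X Y Z = 0"
      unfolding curvature_def parallel_brackets(1)[OF X True YZ(2)]
        parallel_brackets(1)[OF X True connection_closed[OF YZ]]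
      by (simp only: right_minus_eq)
    also have "\<dots> \<longleftrightarrow> curvature X Y Z + curvature X Y Z = 0"
      by (auto simp: fun_eq_iff)
    also have "\<dots> \<longleftrightarrow> sym_bracket D X (sym_bracket D Y Z) =
        sym_bracket D Y (sym_bracket D X Z) + sym_bracket D (sym_bracket D X Y) Z"
      using curvature_sym_bracket[OF X True YZ, symmetric] curvature_parallel_sym[OF X True YZ]
      by (simp only: diff_diff_eq right_minus_eq)
    finally show ?thesis .
  qed
  then show ?thesis using True X unfolding aff0_def aff_def by blast
next
  case False
  then show ?thesis by (auto simp: aff0_def)
qed

text \<open>By the Jacobi identities the vanishing commutator forces \<open>Lie_defect X Z\<close> to vanish. Its values on
  functions \<open>f\<close> show that \<open>X\<close> is parallel, and its values on the differentials \<open>df\<close> give the bracket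
  condition, as \<open>df\<close> evaluated on a vector field \<open>U\<close> is \<open>U f\<close>.\<close>

lemma commutator_Nabla_Lie_imp_aff0:
  assumes X: "X \<in> \<X>" and zero: "op_eq_on A (commutator (Nabla_s A D) (sym_Lie A D X)) 0"
  shows "X \<in> aff0 A D"
proof -
  have defect: "Lie_defect X Z \<Phi> = 0" if "\<Phi> \<in> sym_tensors_sum A" "Z \<in> \<X>" for \<Phi> Z
  proof -
    have "commutator (Nabla_s A D) (sym_Lie A D X) \<Phi> = 0"
      "commutator (Nabla_s A D) (sym_Lie A D X) (iota Z \<Phi>) = 0"
      using zero that sym_tensors_sum_iota[of \<Phi> A Z] by (auto simp: op_eq_on_def)
    moreover have "iota Z 0 = 0" by (simp add: iota_def fun_eq_iff)
    ultimately show ?thesis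
      using commutator_Nabla_Lie_iota[OF sym_tensors_sum_graded[OF that(1)] X that(2)] by simp
  qed
  define fun_tensor :: "('a \<Rightarrow> real) \<Rightarrow> 'a tensor_field" where
    "fun_tensor f = (\<lambda>p vs. if vs = [] then f p else 0)" for f
  have fun_tensor: "fun_tensor f \<in> sym_tensors A 0" if "f \<in> smooth_functions A" for f
    using that by (auto simp: fun_tensor_def sym_tensors_def sym_forms_def eval_tensor_def)
  have eval_fun: "eval_tensor (fun_tensor f) [] = f" for f
    by (simp add: fun_tensor_def eval_tensor_def)
  have parallel: "D Z X = 0" if Z: "Z \<in> \<X>" for Z
  proof (rule vector_field_eqI)
    fix p f assume f: "f \<in> smooth_functions A"
    let ?F = "\<lambda>k::nat. if k = 0 then fun_tensor f else 0"
    have F: "?F \<in> sym_tensors_sum A" by (rule homogeneous_sym_tensors_sum[OF fun_tensor[OF f]])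
    have "(lie_bracket X Z - sym_bracket D X Z) p f = 0"
      using eval_Lie_defect_function[OF sym_tensors_sum_graded[OF F] X Z, of p] defect[OF F Z]
      by (simp add: eval_fun) (simp add: eval_tensor_def)
    then show "D Z X p f = 0 p f"
      unfolding lie_bracket_eq[OF X Z] sym_bracket_def by simp
  qed (use X Z in \<open>auto intro: connection_closed zero_in_vector_fields\<close>)
  have "sym_bracket D X (sym_bracket D Y Z) =
      sym_bracket D Y (sym_bracket D X Z) + sym_bracket D (sym_bracket D X Y) Z"
    if Y: "Y \<in> \<X>" and Z: "Z \<in> \<X>" for Y Z
  proof (rule vector_field_eqI)
    note closed = sym_bracket_closed X Y Z
    fix p f assume f: "f \<in> smooth_functions A"
    let ?F = "\<lambda>k::nat. if k = Suc 0 then sym_deriv A D 0 (fun_tensor f) else 0"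
    have F: "?F \<in> sym_tensors_sum A"
      using homogeneous_sym_tensors_sum[OF sym_deriv_sym_tensor[OF fun_tensor[OF f]]] .
    have df: "eval_tensor (iota U ?F 0) [] p = U p f" if "U \<in> \<X>" for U
      using that eval_sym_deriv[OF fun_tensor[OF f], of "[U]" p] fun_tensor[OF f]
      by (simp add: eval_iota sym_deriv_form_def eval_cov_deriv cov_form_def eval_fun)
    have "iota Z (0 :: 'a graded) = 0" by (simp add: iota_def fun_eq_iff)
    then have "iota (sym_bracket D X (sym_bracket D Y Z)) ?F - iota (sym_bracket D Y (sym_bracket D X Z)) ?F
        - iota (sym_bracket D (sym_bracket D X Y) Z) ?F = 0"
      using Lie_defect_iota[OF sym_tensors_sum_graded[OF F] X Y Z]
        defect[OF F Y] defect[OF sym_tensors_sum_iota[OF F Z] Y] by simp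
    then have "eval_tensor ((iota (sym_bracket D X (sym_bracket D Y Z)) ?F
        - iota (sym_bracket D Y (sym_bracket D X Z)) ?F
        - iota (sym_bracket D (sym_bracket D X Y) Z) ?F) 0) [] p = 0"
      by (simp only:) (simp add: eval_tensor_def)
    then show "sym_bracket D X (sym_bracket D Y Z) p f =
        (sym_bracket D Y (sym_bracket D X Z) + sym_bracket D (sym_bracket D X Y) Z) p f"
      by (simp only: minus_apply eval_tensor_diff df closed) simp
  qed (intro add_in_vector_fields[OF M] sym_bracket_closed X Y Z)+
  with parallel show ?thesis using aff0_iff[OF X] by blast
qed

lemma aff0_imp_Lie_defect_zero:
  assumes X: "X \<in> \<X>" "X \<in> aff0 A D" and Y: "Y \<in> \<X>" and \<Phi>: "\<Phi> \<in> graded_tensors A"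
  shows "Lie_defect X Y \<Phi> = 0"
  using \<Phi>
proof (rule operator_vanishes_by_iota[rotated -1])
  note closed = graded_tensors_Lie graded_tensors_diff[OF M] sym_bracket_closed
  fix \<Phi> assume \<Phi>: "\<Phi> \<in> graded_tensors A"
  show "Lie_defect X Y \<Phi> \<in> graded_tensors A"
    unfolding Lie_defect_def commutator_def using X Y \<Phi> by (intro closed)
  have parallel: "\<forall>Z\<in>\<X>. D Z X = 0" using X(2) aff0_iff[OF X(1)] by blast
  show "eval_tensor (Lie_defect X Y \<Phi> 0) [] p = 0" for p
    unfolding eval_Lie_defect_function[OF \<Phi> X(1) Y] parallel_brackets[OF X(1) parallel Y] by simp
  fix Z assume Z: "Z \<in> \<X>"
  have "sym_bracket D X (sym_bracket D Y Z) =
      sym_bracket D Y (sym_bracket D X Z) + sym_bracket D (sym_bracket D X Y) Z"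
    using X(2) aff0_iff[OF X(1)] Y Z by blast
  then have "iota (sym_bracket D X (sym_bracket D Y Z)) \<Phi> =
      iota (sym_bracket D Y (sym_bracket D X Z)) \<Phi> + iota (sym_bracket D (sym_bracket D X Y) Z) \<Phi>"
    using iota_add[OF \<Phi>] X(1) Y Z by (simp only: sym_bracket_closed)
  then show "iota Z (Lie_defect X Y \<Phi>) = Lie_defect X Y (iota Z \<Phi>)"
    using Lie_defect_iota[OF \<Phi> X(1) Y Z] by simp
qed

lemma aff0_imp_commutator_Nabla_Lie_zero:
  assumes X: "X \<in> \<X>" "X \<in> aff0 A D" and \<Phi>: "\<Phi> \<in> graded_tensors A"
  shows "commutator (Nabla_s A D) (sym_Lie A D X) \<Phi> = 0"
  using \<Phi>
proof (rule operator_vanishes_by_iota[rotated -1])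
  note closed = graded_tensors_Lie graded_tensors_Nabla graded_tensors_diff[OF M]
  fix \<Phi> assume \<Phi>: "\<Phi> \<in> graded_tensors A"
  show "commutator (Nabla_s A D) (sym_Lie A D X) \<Phi> \<in> graded_tensors A"
    unfolding commutator_def using X \<Phi> by (intro closed)
  have "eval_tensor (Nabla_s A D \<Psi> 0) [] = (\<lambda>p. 0)" for \<Psi> :: "'a graded"
    by (simp add: Nabla_s_def eval_tensor_def)
  then show "eval_tensor (commutator (Nabla_s A D) (sym_Lie A D X) \<Phi> 0) [] p = 0" for p
    using X(1) \<Phi> tangent_const[OF vector_field_tangent[OF X(1)], where c = 0]
    by (simp add: commutator_def eval_tensor_diff eval_Lie_function graded_tensors_Nabla)
  fix Z assume "Z \<in> \<X>"
  then show "iota Z (commutator (Nabla_s A D) (sym_Lie A D X) \<Phi>) =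
      commutator (Nabla_s A D) (sym_Lie A D X) (iota Z \<Phi>)"
    using commutator_Nabla_Lie_iota[OF \<Phi> X(1)] aff0_imp_Lie_defect_zero[OF X _ \<Phi>] by simp
qed

lemma commutator_iota_iota:
  assumes "\<Phi> \<in> graded_tensors A" "X \<in> \<X>" "Y \<in> \<X>"
  shows "commutator (iota X) (iota Y) \<Phi> = 0"
proof -
  have "iota X (iota Y \<Phi>) = iota Y (iota X \<Phi>)"
  proof (rule graded_tensors_eqI[OF M])
    fix r Xs p assume "length Xs = r" "set Xs \<subseteq> \<X>"
    then have "eval_tensor (\<Phi> (Suc (Suc r))) (Y # X # Xs) = eval_tensor (\<Phi> (Suc (Suc r))) (X # Y # Xs)"
      using assms
      by (intro sym_multilinear_perm[OF eval_tensor_sym_multilinear[OF graded_tensors_component]]) auto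
    then show "eval_tensor (iota X (iota Y \<Phi>) r) Xs p = eval_tensor (iota Y (iota X \<Phi>) r) Xs p"
      by (simp add: eval_iota)
  qed (use assms in \<open>auto intro: graded_tensors_iota\<close>)
  then show ?thesis by (simp add: commutator_def)
qed

end

theorem theorem4p20:
  fixes A :: "('a::{t2_space,second_countable_topology}, 'e::euclidean_space) atlas"
    and D :: "'a vfield \<Rightarrow> 'a vfield \<Rightarrow> 'a vfield"
    and X Y :: "'a vfield"
  assumes "smooth_manifold A"
    and "affine_connection A D" and "torsion_free A D"
    and "X \<in> vector_fields A" and "Y \<in> vector_fields A"
  shows "(op_eq_on A (commutator (iota X) (iota Y)) 0 \<and>
          op_eq_on A (commutator (Nabla_s A D) (Nabla_s A D)) 0 \<and>
          op_eq_on A (commutator (iota X) (Nabla_s A D)) (sym_Lie A D X) \<and>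
          op_eq_on A (commutator (sym_Lie A D X) (iota Y)) (iota (sym_bracket D X Y)) \<and>
          op_eq_on A (commutator (sym_Lie A D X) (sym_Lie A D Y)) (sym_Lie A D (sym_bracket D X Y)) \<and>
          op_eq_on A (commutator (Nabla_s A D) (sym_Lie A D X)) 0)
         \<longleftrightarrow> X \<in> aff0 A D"
proof -
  interpret torsion_free_manifold A D using assms(1-3) by unfold_locales
  note X = assms(4) and Y = assms(5)
  have "op_eq_on A (commutator (iota X) (iota Y)) 0"
    using commutator_iota_iota[OF sym_tensors_sum_graded X Y] by (simp add: op_eq_on_def)
  moreover have "op_eq_on A (commutator (Nabla_s A D) (Nabla_s A D)) 0"
    by (simp add: op_eq_on_def commutator_def)
  moreover have "op_eq_on A (commutator (iota X) (Nabla_s A D)) (sym_Lie A D X)"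
    by (simp add: op_eq_on_def commutator_def sym_Lie_def)
  moreover have "op_eq_on A (commutator (sym_Lie A D X) (iota Y)) (iota (sym_bracket D X Y))"
    using Lie_iota[OF sym_tensors_sum_graded X Y] by (simp add: op_eq_on_def commutator_def)
  moreover have "op_eq_on A (commutator (sym_Lie A D X) (sym_Lie A D Y)) (sym_Lie A D (sym_bracket D X Y))"
    if "X \<in> aff0 A D"
    using aff0_imp_Lie_defect_zero[OF X that Y sym_tensors_sum_graded]
    by (simp add: op_eq_on_def Lie_defect_def)
  moreover have "op_eq_on A (commutator (Nabla_s A D) (sym_Lie A D X)) 0" if "X \<in> aff0 A D"
    using aff0_imp_commutator_Nabla_Lie_zero[OF X that sym_tensors_sum_graded]
    by (simp add: op_eq_on_def)
  ultimately show ?thesis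
    using commutator_Nabla_Lie_imp_aff0[OF X] by blast
qed

end
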